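(* Let $n\ge2$ and let $X\in M(n,\mathbb{C})$ with $\|X\|=1$. Then $\lambda_1(T_X)\le 2\|X\|_{(2),2}^2\le 2$.
   Context: $M(n,\mathbb{C})$ is the space of complex $n\times n$ matrices, $X^*$ is the conjugate transpose, $\|X\|=\sqrt{\operatorname{Tr}XX^*}$ is the Frobenius norm, $[X,Y]=XY-YX$. With $\sigma_1(X)\ge\sigma_2(X)\ge\cdots\ge\sigma_n(X)$ the singular values of $X$, the $(2,2)$-norm is $\|X\|_{(2),2}=\sqrt{\sigma_1^2(X)+\sigma_2^2(X)}$. $T_X$ is the linear map on $M(n,\mathbb{C})$ given by $T_X(Y)=[X^*,[X,Y]]$; it is self-adjoint and positive semi-definite for $\langle Y,Z\rangle=\operatorname{Tr}(YZ^* )$, and $\lambda_1(T_X)$ is its largest eigenvalue. *)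

theory Defs
  imports
    "HOL-Computational_Algebra.Fundamental_Theorem_Algebra"
    "Jordan_Normal_Form.Char_Poly"
    "Jordan_Normal_Form.Schur_Decomposition"
begin

definition mat_trace :: "complex mat \<Rightarrow> complex" where
  "mat_trace A = (\<Sum>i<dim_row A. A $$ (i, i))"

text \<open>The trace of \<open>X X\<^sup>*\<close> is a nonnegative real, so taking the real part loses nothing.\<close>

definition frobenius_norm :: "complex mat \<Rightarrow> real" where
  "frobenius_norm X = sqrt (Re (mat_trace (X * mat_adjoint X)))"

text \<open>
  The singular values are the square roots of the eigenvalues of the positive semi-definite
  matrix \<open>X\<^sup>* X\<close>, counted with algebraic multiplicity (\<open>proots\<close> is the multiset of roots
  of a polynomial) and listed in decreasing order. These eigenvalues are real and nonnegative.
\<close>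

definition singular_values :: "complex mat \<Rightarrow> real list" where
  "singular_values X =
     rev (sorted_list_of_multiset
       (image_mset (\<lambda>z. sqrt (Re z)) (proots (char_poly (mat_adjoint X * X)))))"

text \<open>Indexed from 1, so that \<open>singular_value X 1\<close> is the largest one; only meaningful for
  \<open>1 \<le> k \<le> n\<close> when \<open>X\<close> is \<open>n \<times> n\<close>.\<close>

definition singular_value :: "complex mat \<Rightarrow> nat \<Rightarrow> real" where
  "singular_value X k = singular_values X ! (k - 1)"

definition norm_2_2 :: "complex mat \<Rightarrow> real" where
  "norm_2_2 X = sqrt ((singular_value X 1)\<^sup>2 + (singular_value X 2)\<^sup>2)"

definition commutator :: "complex mat \<Rightarrow> complex mat \<Rightarrow> complex mat" where
  "commutator X Y = X * Y - Y * X"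

definition T_map :: "complex mat \<Rightarrow> complex mat \<Rightarrow> complex mat" where
  "T_map X Y = commutator (mat_adjoint X) (commutator X Y)"

definition map_eigenvalue :: "nat \<Rightarrow> (complex mat \<Rightarrow> complex mat) \<Rightarrow> complex \<Rightarrow> bool" where
  "map_eigenvalue n T c \<longleftrightarrow>
     (\<exists>Y \<in> carrier_mat n n. Y \<noteq> 0\<^sub>m n n \<and> T Y = c \<cdot>\<^sub>m Y)"

text \<open>Only used for maps that are linear and self-adjoint on \<open>carrier_mat n n\<close> with \<open>n \<ge> 1\<close>:
  all eigenvalues are then real and the set below is finite and nonempty.\<close>

definition largest_eigenvalue :: "nat \<Rightarrow> (complex mat \<Rightarrow> complex mat) \<Rightarrow> real" where
  "largest_eigenvalue n T = Max {r :: real. map_eigenvalue n T (complex_of_real r)}"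

lemma size_proots_complex:
  fixes p :: "complex poly"
  assumes "p \<noteq> 0"
  shows "size (proots p) = degree p"
  using assms
proof (induction "degree p" arbitrary: p)
  case 0
  then obtain c where "p = [:c:]" by (metis degree_eq_zeroE)
  then show ?case by simp
next
  case (Suc d)
  then have "\<not> constant (poly p)" by (simp add: constant_degree)
  then obtain z where "poly p z = 0" using fundamental_theorem_of_algebra by blast
  then obtain q where q: "p = [:-z, 1:] * q" by (metis dvdE poly_eq_0_iff_dvd)
  with Suc.prems have q0: "q \<noteq> 0" by auto
  have "degree p = Suc (degree q)" unfolding q using q0 by (subst degree_mult_eq) auto
  with Suc q0 have "size (proots q) = d" by simp
  moreover have "proots p = {#z#} + proots q" unfolding q using q0 by (subst proots_mult) auto
  ultimately show ?case using Suc by simp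
qed

lemma length_singular_values:
  assumes "X \<in> carrier_mat n n"
  shows "length (singular_values X) = n"
proof -
  have A: "mat_adjoint X * X \<in> carrier_mat n n"
    using assms by (auto simp: mat_adjoint_def)
  then have "char_poly (mat_adjoint X * X) \<noteq> 0"
    using degree_monic_char_poly[OF A] by auto
  then show ?thesis using degree_monic_char_poly[OF A]
    by (simp add: singular_values_def size_proots_complex flip: size_mset)
qed

end

theory Submission
  imports Defs
begin

text \<open>
  Write \<open>B = \<sigma>\<^sub>1\<^sup>2 + \<sigma>\<^sub>2\<^sup>2\<close> for the squared (2,2)-norm of \<open>X\<close>, and \<open>[X,Y]\<close> for the commutator. Since
  \<open>ad X\<^sup>*\<close> is the Frobenius adjoint of \<open>ad X\<close>, an eigenvector \<open>Y\<close> of \<open>T\<^sub>X\<close> for the eigenvalue \<open>\<lambda>\<close>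
  satisfies \<open>\<lambda> \<parallel>Y\<parallel>\<^sup>2 = \<parallel>[X,Y]\<parallel>\<^sup>2\<close>. So everything rests on the commutator inequality
  \<open>\<parallel>[X,Y]\<parallel>\<^sup>2 \<le> 2 B \<parallel>Y\<parallel>\<^sup>2\<close>, which is proved by reading its left-hand side as a variance
  (an idea of Audenaert).

  Let \<open>D = X\<^sup>* Y + Y X\<^sup>*\<close>. The mixed terms of \<open>\<parallel>[X,Y]\<parallel>\<^sup>2\<close> and \<open>\<parallel>D\<parallel>\<^sup>2\<close> cancel
  (\<open>commutator_anticommutator_identity\<close>), and the sum of the two is \<open>Tr \<rho> (X\<^sup>* X + X X\<^sup>*)\<close> for the
  positive matrix \<open>\<rho> = Y Y\<^sup>* + Y\<^sup>* Y\<close> of trace \<open>2 \<parallel>Y\<parallel>\<^sup>2\<close>. On the other hand \<open>\<langle>D, Y\<rangle>\<close> is, up to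
  conjugation, \<open>Tr \<rho> X\<close>, so that \<open>\<parallel>D\<parallel>\<^sup>2 \<parallel>Y\<parallel>\<^sup>2 \<ge> |Tr \<rho> X|\<^sup>2\<close> by Cauchy-Schwarz. Hence it suffices to
  bound \<open>Tr \<rho> (X\<^sup>* X + X X\<^sup>*)\<close> by \<open>B Tr \<rho> + |Tr \<rho> X|\<^sup>2 / Tr \<rho>\<close> (\<open>density_variance_bound\<close>): the
  last term is at most \<open>\<parallel>D\<parallel>\<^sup>2 / 2\<close>.

  For \<open>\<rho> = v v\<^sup>*\<close> with a unit vector \<open>v\<close> this is easy (\<open>pure_state_bound\<close>): the component of \<open>X\<^sup>* v\<close>
  along \<open>v\<close> contributes \<open>|\<langle>X v, v\<rangle>|\<^sup>2\<close>, and the orthogonal component is no longer than \<open>X w\<close> for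
  the unit vector \<open>w\<close> in its direction. As \<open>v\<close> and \<open>w\<close> are orthonormal,
  \<open>\<parallel>X v\<parallel>\<^sup>2 + \<parallel>X w\<parallel>\<^sup>2 \<le> B\<close> by Ky Fan's maximum principle (\<open>ky_fan_two\<close>).

  For general \<open>\<rho>\<close> the variance is concave in \<open>\<rho>\<close>, so averaging over an arbitrary decomposition into
  rank-one matrices goes the wrong way. But \<open>\<rho>\<close> can be written as a sum of matrices \<open>w w\<^sup>*\<close> with
  vectors \<open>w\<close> of the same mean, \<open>\<langle>X w, w\<rangle> = c \<parallel>w\<parallel>\<^sup>2\<close> for \<open>c = Tr \<rho> X / Tr \<rho>\<close>, and then the rank-one
  bounds simply add up. After subtracting a multiple of the identity from \<open>X\<close>, the existence of such a
  decomposition is the statement that a matrix of trace zero is unitarily similar to one with zero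
  diagonal (\<open>zero_diagonal_decomposition\<close>).

  The inequality \<open>B \<le> 1\<close> holds because the squares of all singular values add up to
  \<open>Tr X\<^sup>* X = \<parallel>X\<parallel>\<^sup>2 = 1\<close>; the singular values are computed from an orthonormal eigenbasis of
  \<open>X\<^sup>* X\<close> (\<open>singular_system_exists\<close>).
\<close>

section \<open>Orthonormal families of complex functions on a finite set\<close>

text \<open>
  Vectors are functions on a finite index set, without any condition outside that set, so that sums
  and multiples are plain lambda terms. With \<open>S = {..<n}\<close> this is the inner product of \<open>\<complex>\<^sup>n\<close>, and with
  \<open>S = {..<n} \<times> {..<n}\<close> the Frobenius inner product.
\<close>

definition hinner :: "'i set \<Rightarrow> ('i \<Rightarrow> complex) \<Rightarrow> ('i \<Rightarrow> complex) \<Rightarrow> complex" where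
  "hinner S f g = (\<Sum>i\<in>S. f i * cnj (g i))"

definition sqnorm :: "'i set \<Rightarrow> ('i \<Rightarrow> complex) \<Rightarrow> real" where
  "sqnorm S f = (\<Sum>i\<in>S. (cmod (f i))\<^sup>2)"

lemma hinner_self: "hinner S f f = complex_of_real (sqnorm S f)"
  by (simp add: hinner_def sqnorm_def complex_norm_square del: of_real_power)

lemma cnj_hinner: "cnj (hinner S f g) = hinner S g f"
  by (simp add: hinner_def mult.commute)

lemma hinner_diff_left: "hinner S (\<lambda>i. f i - g i) h = hinner S f h - hinner S g h"
  by (simp add: hinner_def algebra_simps sum_subtractf)

lemma hinner_diff_right: "hinner S h (\<lambda>i. f i - g i) = hinner S h f - hinner S h g"
  by (simp add: hinner_def algebra_simps sum_subtractf)

lemma hinner_scale_left: "hinner S (\<lambda>i. c * f i) h = c * hinner S f h"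
  by (simp add: hinner_def algebra_simps sum_distrib_left)

lemma hinner_scale_right: "hinner S h (\<lambda>i. c * f i) = cnj c * hinner S h f"
  by (simp add: hinner_def algebra_simps sum_distrib_left)

lemma hinner_sum_left: "hinner S (\<lambda>i. \<Sum>k\<in>K. F k i) h = (\<Sum>k\<in>K. hinner S (F k) h)"
  by (simp add: hinner_def sum_distrib_right, rule sum.swap)

lemma hinner_sum_right: "hinner S h (\<lambda>i. \<Sum>k\<in>K. F k i) = (\<Sum>k\<in>K. hinner S h (F k))"
  by (simp add: hinner_def sum_distrib_left, rule sum.swap)

lemma hinner_cong: "(\<And>i. i \<in> S \<Longrightarrow> f i = f' i) \<Longrightarrow> (\<And>i. i \<in> S \<Longrightarrow> g i = g' i) \<Longrightarrow>
    hinner S f g = hinner S f' g'"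
  by (simp add: hinner_def)

lemma sqnorm_cong: "(\<And>i. i \<in> S \<Longrightarrow> f i = f' i) \<Longrightarrow> sqnorm S f = sqnorm S f'"
  by (simp add: sqnorm_def)

lemma sqnorm_nonneg: "0 \<le> sqnorm S f"
  by (simp add: sqnorm_def sum_nonneg)

lemma sqnorm_scale: "sqnorm S (\<lambda>i. c * f i) = (cmod c)\<^sup>2 * sqnorm S f"
  by (simp add: sqnorm_def norm_mult power_mult_distrib sum_distrib_left)

lemma sqnorm_eq_0: "finite S \<Longrightarrow> sqnorm S f = 0 \<longleftrightarrow> (\<forall>i\<in>S. f i = 0)"
  by (simp add: sqnorm_def sum_nonneg_eq_0_iff)

definition orthonormal_family :: "'i set \<Rightarrow> 'k set \<Rightarrow> ('k \<Rightarrow> 'i \<Rightarrow> complex) \<Rightarrow> bool" where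
  "orthonormal_family S K u \<longleftrightarrow> (\<forall>k\<in>K. \<forall>l\<in>K. hinner S (u k) (u l) = of_bool (k = l))"

text \<open>
  The component of \<open>f\<close> orthogonal to the span of an orthonormal family.
\<close>

definition residual ::
    "'i set \<Rightarrow> 'k set \<Rightarrow> ('k \<Rightarrow> 'i \<Rightarrow> complex) \<Rightarrow> ('i \<Rightarrow> complex) \<Rightarrow> 'i \<Rightarrow> complex" where
  "residual S K u f = (\<lambda>i. f i - (\<Sum>k\<in>K. hinner S f (u k) * u k i))"

lemma residual_orthogonal:
  assumes "finite K" and "orthonormal_family S K u" and "l \<in> K"
  shows "hinner S (residual S K u f) (u l) = 0"
proof -
  have "hinner S (residual S K u f) (u l)
      = hinner S f (u l) - (\<Sum>k\<in>K. hinner S f (u k) * hinner S (u k) (u l))"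
    by (simp add: residual_def hinner_diff_left hinner_sum_left hinner_scale_left)
  also have "(\<Sum>k\<in>K. hinner S f (u k) * hinner S (u k) (u l))
      = (\<Sum>k\<in>K. if k = l then hinner S f (u k) else 0)"
    using assms by (intro sum.cong) (auto simp: orthonormal_family_def)
  also have "\<dots> = hinner S f (u l)" using assms by simp
  finally show ?thesis by simp
qed

lemma sqnorm_residual:
  assumes "finite K" and "orthonormal_family S K u"
  shows "sqnorm S (residual S K u f) = sqnorm S f - (\<Sum>k\<in>K. (cmod (hinner S f (u k)))\<^sup>2)"
proof -
  let ?g = "residual S K u f"
  have "complex_of_real (sqnorm S ?g) = hinner S ?g ?g" by (simp add: hinner_self)
  also have "\<dots> = hinner S ?g f - (\<Sum>k\<in>K. cnj (hinner S f (u k)) * hinner S ?g (u k))"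
    by (subst (2) residual_def) (simp add: hinner_diff_right hinner_sum_right hinner_scale_right)
  also have "\<dots> = hinner S ?g f" using residual_orthogonal[OF assms] by simp
  also have "\<dots> = hinner S f f - (\<Sum>k\<in>K. hinner S f (u k) * hinner S (u k) f)"
    by (simp add: residual_def hinner_diff_left hinner_sum_left hinner_scale_left)
  also have "\<dots> = complex_of_real (sqnorm S f - (\<Sum>k\<in>K. (cmod (hinner S f (u k)))\<^sup>2))"
    by (simp add: hinner_self complex_norm_square cnj_hinner del: of_real_power)
  finally show ?thesis using of_real_eq_iff by blast
qed

lemma bessel:
  assumes "finite K" and "orthonormal_family S K u"
  shows "(\<Sum>k\<in>K. (cmod (hinner S f (u k)))\<^sup>2) \<le> sqnorm S f"
  using sqnorm_residual[OF assms, of f] sqnorm_nonneg[of S "residual S K u f"] by simp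

definition normalized :: "'i set \<Rightarrow> ('i \<Rightarrow> complex) \<Rightarrow> 'i \<Rightarrow> complex" where
  "normalized S f = (\<lambda>i. complex_of_real (1 / sqrt (sqnorm S f)) * f i)"

lemma sqnorm_normalized:
  assumes "sqnorm S f \<noteq> 0"
  shows "sqnorm S (normalized S f) = 1"
  using assms sqnorm_nonneg[of S f]
  by (simp add: normalized_def sqnorm_scale norm_divide power_divide del: of_real_divide)

lemma hinner_normalized_self:
  "sqnorm S f \<noteq> 0 \<Longrightarrow> hinner S (normalized S f) (normalized S f) = 1"
  by (simp add: hinner_self sqnorm_normalized)

lemma cauchy_schwarz:
  assumes "finite S"
  shows "(cmod (hinner S f g))\<^sup>2 \<le> sqnorm S f * sqnorm S g"
proof (cases "sqnorm S g = 0")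
  case True
  then have "\<forall>i\<in>S. g i = 0" using assms by (simp add: sqnorm_eq_0)
  then have "hinner S f g = 0" by (simp add: hinner_def)
  then show ?thesis using True by simp
next
  case False
  have "orthonormal_family S {()} (\<lambda>_. normalized S g)"
    using hinner_normalized_self[OF False] by (simp add: orthonormal_family_def)
  from bessel[OF _ this, of f] have "(cmod (hinner S f (normalized S g)))\<^sup>2 \<le> sqnorm S f"
    by simp
  moreover have "(cmod (hinner S f (normalized S g)))\<^sup>2 = (cmod (hinner S f g))\<^sup>2 / sqnorm S g"
    using sqnorm_nonneg[of S g]
    by (simp add: normalized_def hinner_scale_right norm_mult norm_divide power_divide
        del: of_real_divide)
  ultimately show ?thesis using False sqnorm_nonneg[of S g] by (simp add: field_simps)
qed

text \<open>
  Bessel's inequality for each coordinate vector \<open>e\<^sub>p\<close> gives \<open>\<Sum>k. |u\<^sub>k(p)|\<^sup>2 \<le> 1\<close>; summing over \<open>p\<close>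
  counts the members of the family.
\<close>

lemma card_orthonormal_family_le:
  assumes "finite S" and "finite K" and "orthonormal_family S K u"
  shows "card K \<le> card S"
proof -
  have "real (card K) = (\<Sum>k\<in>K. sqnorm S (u k))"
  proof -
    have "sqnorm S (u k) = 1" if "k \<in> K" for k
    proof -
      have "complex_of_real (sqnorm S (u k)) = 1"
        using assms(3) that by (simp add: orthonormal_family_def flip: hinner_self)
      then show ?thesis by simp
    qed
    then show ?thesis by simp
  qed
  also have "\<dots> = (\<Sum>p\<in>S. \<Sum>k\<in>K. (cmod (u k p))\<^sup>2)"
    unfolding sqnorm_def by (rule sum.swap)
  also have "\<dots> \<le> (\<Sum>p\<in>S. 1)"
  proof (rule sum_mono)
    fix p assume p: "p \<in> S"
    let ?e = "\<lambda>i. of_bool (i = p) :: complex"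
    have "hinner S ?e (u k) = (\<Sum>i\<in>S. if i = p then cnj (u k p) else 0)" for k
      unfolding hinner_def by (intro sum.cong) auto
    then have 1: "hinner S ?e (u k) = cnj (u k p)" for k using p assms(1) by simp
    have "sqnorm S ?e = (\<Sum>i\<in>S. if i = p then 1 else 0)"
      unfolding sqnorm_def by (intro sum.cong) auto
    then have 2: "sqnorm S ?e = 1" using p assms(1) by simp
    from bessel[OF assms(2,3), of ?e] show "(\<Sum>k\<in>K. (cmod (u k p))\<^sup>2) \<le> 1"
      by (simp add: 1 2)
  qed
  finally show ?thesis by simp
qed

section \<open>Matrices acting on coordinate functions\<close>

definition act :: "nat \<Rightarrow> complex mat \<Rightarrow> (nat \<Rightarrow> complex) \<Rightarrow> nat \<Rightarrow> complex" where
  "act n X v = (\<lambda>i. \<Sum>j<n. X $$ (i, j) * v j)"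

lemma act_scale: "act n X (\<lambda>j. c * v j) = (\<lambda>i. c * act n X v i)"
  by (auto simp: act_def sum_distrib_left algebra_simps)

lemma act_diff: "act n X (\<lambda>j. v j - w j) = (\<lambda>i. act n X v i - act n X w i)"
  by (auto simp: act_def sum_subtractf algebra_simps)

lemma act_sum: "act n X (\<lambda>j. \<Sum>k\<in>K. F k j) = (\<lambda>i. \<Sum>k\<in>K. act n X (F k) i)"
proof
  fix i show "act n X (\<lambda>j. \<Sum>k\<in>K. F k j) i = (\<Sum>k\<in>K. act n X (F k) i)"
    unfolding act_def sum_distrib_left by (rule sum.swap)
qed

lemma adjoint_carrier [simp]:
  "X \<in> carrier_mat n m \<Longrightarrow> mat_adjoint X \<in> carrier_mat m n"
  by (auto simp: mat_adjoint_def)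

lemma square_mult_carrier [simp]:
  "A \<in> carrier_mat n n \<Longrightarrow> B \<in> carrier_mat n n \<Longrightarrow> A * B \<in> carrier_mat n n"
  by (rule mult_carrier_mat)

lemma adjoint_dim [simp]:
  "dim_row (mat_adjoint X) = dim_col X" "dim_col (mat_adjoint X) = dim_row X"
  by (simp_all add: mat_adjoint_def)

lemma adjoint_index [simp]:
  assumes "X \<in> carrier_mat n m" "i < m" "j < n"
  shows "mat_adjoint X $$ (i, j) = cnj (X $$ (j, i))"
  using assms by (simp add: mat_adjoint_def mat_of_rows_index)

lemma adjoint_adjoint:
  fixes X :: "complex mat"
  shows "X \<in> carrier_mat n m \<Longrightarrow> mat_adjoint (mat_adjoint X) = X"
  by (rule eq_matI) (auto simp: adjoint_index[OF adjoint_carrier] mat_adjoint_def mat_of_rows_index)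

lemma mat_mult_index:
  assumes "X \<in> carrier_mat n m" "Y \<in> carrier_mat m k" "i < n" "j < k"
  shows "(X * Y) $$ (i, j) = (\<Sum>l<m. X $$ (i, l) * Y $$ (l, j))"
  using assms by (simp add: scalar_prod_def lessThan_atLeast0)

lemma adjoint_mult:
  fixes X Y :: "complex mat"
  assumes "X \<in> carrier_mat n m" "Y \<in> carrier_mat m k"
  shows "mat_adjoint (X * Y) = mat_adjoint Y * mat_adjoint X"
proof (rule eq_matI)
  have XY: "X * Y \<in> carrier_mat n k" using assms by simp
  note a = adjoint_carrier[OF assms(1)] adjoint_carrier[OF assms(2)]
  show "dim_row (mat_adjoint (X * Y)) = dim_row (mat_adjoint Y * mat_adjoint X)"
    "dim_col (mat_adjoint (X * Y)) = dim_col (mat_adjoint Y * mat_adjoint X)"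
    using a adjoint_carrier[OF XY] by auto
  fix i j assume "i < dim_row (mat_adjoint Y * mat_adjoint X)" 
    "j < dim_col (mat_adjoint Y * mat_adjoint X)"
  then have ij: "i < k" "j < n" using a by auto
  show "mat_adjoint (X * Y) $$ (i, j) = (mat_adjoint Y * mat_adjoint X) $$ (i, j)"
    using ij assms
    by (simp add: adjoint_index[OF XY] mat_mult_index[OF a(2) a(1)] mat_mult_index[OF assms]
        del: index_mult_mat) (simp add: mult.commute)
qed

lemma hinner_act_left:
  assumes "X \<in> carrier_mat n n"
  shows "hinner {..<n} (act n X v) w = hinner {..<n} v (act n (mat_adjoint X) w)"
proof -
  have "hinner {..<n} (act n X v) w = (\<Sum>i<n. \<Sum>j<n. X $$ (i, j) * v j * cnj (w i))"
    by (simp add: hinner_def act_def sum_distrib_right)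
  also have "\<dots> = (\<Sum>j<n. \<Sum>i<n. X $$ (i, j) * v j * cnj (w i))" by (rule sum.swap)
  also have "\<dots> = hinner {..<n} v (act n (mat_adjoint X) w)"
    using assms by (simp add: hinner_def act_def sum_distrib_left mult_ac)
  finally show ?thesis .
qed

lemma act_mult:
  assumes "X \<in> carrier_mat n n" "Y \<in> carrier_mat n n" "i < n"
  shows "act n (X * Y) v i = act n X (act n Y v) i"
proof -
  have "act n (X * Y) v i = (\<Sum>j<n. \<Sum>l<n. X $$ (i, l) * Y $$ (l, j) * v j)"
    using assms by (simp add: act_def mat_mult_index[OF assms(1,2)] sum_distrib_right del: index_mult_mat)
  also have "\<dots> = (\<Sum>l<n. \<Sum>j<n. X $$ (i, l) * Y $$ (l, j) * v j)" by (rule sum.swap)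
  also have "\<dots> = act n X (act n Y v) i" by (simp add: act_def sum_distrib_left mult_ac)
  finally show ?thesis .
qed

lemma mat_trace_mult:
  assumes "A \<in> carrier_mat n n" "B \<in> carrier_mat n n"
  shows "mat_trace (A * B) = (\<Sum>i<n. \<Sum>j<n. A $$ (i, j) * B $$ (j, i))"
  using assms(1) by (simp add: mat_trace_def mat_mult_index[OF assms] del: index_mult_mat(1))

lemma mat_trace_comm:
  assumes "A \<in> carrier_mat n n" "B \<in> carrier_mat n n"
  shows "mat_trace (A * B) = mat_trace (B * A)"
  unfolding mat_trace_mult[OF assms] mat_trace_mult[OF assms(2,1)]
  by (subst sum.swap) (simp add: mult.commute)

section \<open>Orthonormal eigenbases of Hermitian matrices\<close>

lemma hermitian_eigenvalue_real:
  assumes "A \<in> carrier_mat n n" "mat_adjoint A = A"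
    and "hinner {..<n} v v = 1" "\<And>i. i < n \<Longrightarrow> act n A v i = d * v i"
  shows "cnj d = d"
proof -
  let ?S = "{..<n}"
  have e: "hinner ?S (act n A v) v = d"
    using assms(3,4) hinner_scale_left[of ?S d v v] hinner_cong[of ?S "act n A v" "\<lambda>i. d * v i" v v]
    by simp
  have "cnj d = hinner ?S v (act n A v)" by (subst e[symmetric]) (rule cnj_hinner)
  also have "\<dots> = d" using hinner_act_left[OF assms(1), of v v] assms(2) e by simp
  finally show ?thesis .
qed

text \<open>
  The Schur form \<open>A P = P B\<close> read column by column: \<open>A\<close> maps the \<open>m\<close>-th column of \<open>P\<close> into the span of
  the first \<open>m + 1\<close> columns, and the coordinate vectors are combinations of the columns because \<open>P\<close>
  is invertible.
\<close>

lemma triangularizing_basis: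
  fixes A :: "complex mat"
  assumes A: "A \<in> carrier_mat n n"
  obtains p b c where
    "\<And>m i. m < n \<Longrightarrow> i < n \<Longrightarrow> act n A (p m) i = (\<Sum>l\<le>m. b l m * p l i)"
    "\<And>r i. r < n \<Longrightarrow> i < n \<Longrightarrow> of_bool (i = r) = (\<Sum>m<n. c r m * p m i)"
proof -
  obtain es where es: "char_poly A = (\<Prod>e\<leftarrow>es. [:- e, 1:])"
    using char_poly_factorized[OF A] by blast
  obtain B P Q where "schur_decomposition A es = (B, P, Q)" by (metis prod_cases3)
  with schur_decomposition[OF A es] have ut: "upper_triangular B" and sim: "similar_mat_wit A B P Q"
    by simp_all
  note D = similar_mat_witD2[OF A sim]
  note PQ = D(1) and A_eq = D(3) and B = D(5) and P = D(6) and Q = D(7)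
  have AP: "A * P = P * B"
  proof -
    have "A * P = P * B * (Q * P)" unfolding A_eq using B P Q by (simp add: assoc_mult_mat[of _ n n _ n _ n])
    then show ?thesis using D(2) B P by simp
  qed
  show thesis
  proof (rule that[of "\<lambda>m i. P $$ (i, m)" "\<lambda>l m. B $$ (l, m)" "\<lambda>r m. Q $$ (m, r)"])
    fix m i assume mi: "m < n" "i < n"
    have "act n A (\<lambda>i. P $$ (i, m)) i = (A * P) $$ (i, m)"
      using mi by (simp add: act_def mat_mult_index[OF A P] del: index_mult_mat)
    also have "\<dots> = (\<Sum>l<n. P $$ (i, l) * B $$ (l, m))"
      using mi by (simp add: AP mat_mult_index[OF P B] del: index_mult_mat)
    also have "\<dots> = (\<Sum>l\<le>m. P $$ (i, l) * B $$ (l, m))"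
      using mi ut B by (intro sum.mono_neutral_right) (auto simp: upper_triangular_def)
    finally show "act n A (\<lambda>i. P $$ (i, m)) i = (\<Sum>l\<le>m. B $$ (l, m) * P $$ (i, l))"
      by (simp add: mult.commute)
  next
    fix r i assume ri: "r < n" "i < n"
    have "(P * Q) $$ (i, r) = of_bool (i = r)" using ri by (simp add: PQ)
    then show "of_bool (i = r) = (\<Sum>m<n. Q $$ (m, r) * P $$ (i, m))"
      using ri by (simp add: mat_mult_index[OF P Q] mult.commute del: index_mult_mat)
  qed
qed

lemma residual_sum:
  "residual S K u (\<lambda>i. \<Sum>m\<in>M. c m * p m i) i = (\<Sum>m\<in>M. c m * residual S K u (p m) i)"
proof -
  have "(\<Sum>k\<in>K. (\<Sum>m\<in>M. c m * hinner S (p m) (u k)) * u k i)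
      = (\<Sum>k\<in>K. \<Sum>m\<in>M. c m * (hinner S (p m) (u k) * u k i))"
    by (simp add: sum_distrib_right mult.assoc)
  also have "\<dots> = (\<Sum>m\<in>M. \<Sum>k\<in>K. c m * (hinner S (p m) (u k) * u k i))" by (rule sum.swap)
  finally show ?thesis
    by (simp add: residual_def hinner_sum_left hinner_scale_left right_diff_distrib sum_subtractf
        sum_distrib_left)
qed

lemma residual_cong:
  "(\<And>i. i \<in> S \<Longrightarrow> f i = g i) \<Longrightarrow> i \<in> S \<Longrightarrow> residual S K u f i = residual S K u g i"
  using hinner_cong[of S f g] by (simp add: residual_def)

text \<open>
  An orthonormal family with fewer than \<open>n\<close> members does not span: otherwise the projection
  \<open>\<Sum>j. u\<^sub>j u\<^sub>j\<^sup>*\<close> would be the identity, and comparing traces would give \<open>k = n\<close>.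
\<close>

lemma residual_nonzero_unit_vector:
  fixes n k :: nat
  assumes "orthonormal_family {..<n} {..<k} u" "k < n"
  obtains r i where "r < n" "i < n" "residual {..<n} {..<k} u (\<lambda>i. of_bool (i = r)) i \<noteq> 0"
proof (rule ccontr)
  assume "\<not> thesis"
  with that have z: "\<And>r. r < n \<Longrightarrow> residual {..<n} {..<k} u (\<lambda>i. of_bool (i = r)) r = 0"
    by blast
  have e: "hinner {..<n} (\<lambda>i. of_bool (i = r)) (u j) = cnj (u j r)" if "r < n" for r j
  proof -
    have "hinner {..<n} (\<lambda>i. of_bool (i = r)) (u j) = (\<Sum>i<n. if i = r then cnj (u j r) else 0)"
      unfolding hinner_def by (intro sum.cong) auto
    then show ?thesis using that by simp
  qed
  have "(\<Sum>j<k. u j r * cnj (u j r)) = 1" if "r < n" for r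
    using z[OF that] by (simp add: residual_def e that mult.commute)
  then have "of_nat n = (\<Sum>r<n. \<Sum>j<k. u j r * cnj (u j r))" by simp
  also have "\<dots> = (\<Sum>j<k. hinner {..<n} (u j) (u j))" unfolding hinner_def by (rule sum.swap)
  also have "\<dots> = of_nat k" using assms(1) by (simp add: orthonormal_family_def)
  finally show False using assms(2) by simp
qed

text \<open>
  Let \<open>Q\<close> be the projection onto the complement of the eigenvectors found so far. It commutes with
  \<open>A\<close>, because \<open>A\<close> is Hermitian. Take the first vector \<open>p\<^sub>m\<close> of a triangularizing basis with
  \<open>Q p\<^sub>m \<noteq> 0\<close>. In \<open>A Q p\<^sub>m = Q A p\<^sub>m = \<Sum>l\<le>m. b\<^sub>l\<^sub>m Q p\<^sub>l\<close> only the term \<open>l = m\<close> survives, so \<open>Q p\<^sub>m\<close> is an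
  eigenvector.
\<close>

lemma next_orthonormal_eigenvector:
  assumes A: "A \<in> carrier_mat n n" "mat_adjoint A = A" and "k < n"
    and u: "orthonormal_family {..<n} {..<k} u"
    and ev: "\<And>j i. j < k \<Longrightarrow> i < n \<Longrightarrow> act n A (u j) i = d j * u j i"
  obtains v e where "hinner {..<n} v v = 1" "\<And>j. j < k \<Longrightarrow> hinner {..<n} v (u j) = 0"
    "\<And>i. i < n \<Longrightarrow> act n A v i = e * v i"
proof -
  let ?S = "{..<n}"
  let ?Q = "residual ?S {..<k} u"
  obtain p b c where
    p: "\<And>m i. m < n \<Longrightarrow> i < n \<Longrightarrow> act n A (p m) i = (\<Sum>l\<le>m. b l m * p l i)" and
    c: "\<And>r i. r < n \<Longrightarrow> i < n \<Longrightarrow> of_bool (i = r) = (\<Sum>m<n. c r m * p m i)"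
    using triangularizing_basis[OF A(1)] by blast
  have "\<exists>m. m < n \<and> (\<exists>i<n. ?Q (p m) i \<noteq> 0)"
  proof (rule ccontr)
    assume none: "\<not> ?thesis"
    obtain r i where ri: "r < n" "i < n" "?Q (\<lambda>i. of_bool (i = r)) i \<noteq> 0"
      using residual_nonzero_unit_vector[OF u \<open>k < n\<close>] .
    have "?Q (\<lambda>i. of_bool (i = r)) i = ?Q (\<lambda>i. \<Sum>m<n. c r m * p m i) i"
      by (rule residual_cong) (use ri(1,2) c in blast)+
    also have "\<dots> = (\<Sum>m<n. c r m * ?Q (p m) i)" by (rule residual_sum)
    also have "\<dots> = 0"
    proof (rule sum.neutral, rule ballI)
      fix m assume "m \<in> {..<n}"
      then have "?Q (p m) i = 0" using none ri(2) by blast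
      then show "c r m * ?Q (p m) i = 0" by simp
    qed
    finally show False using ri(3) by simp
  qed
  then obtain m where m: "m < n" "\<exists>i<n. ?Q (p m) i \<noteq> 0"
    and "\<forall>l<m. \<not> (l < n \<and> (\<exists>i<n. ?Q (p l) i \<noteq> 0))"
    using exists_least_iff[of "\<lambda>m. m < n \<and> (\<exists>i<n. ?Q (p m) i \<noteq> 0)"] by blast
  then have least: "?Q (p l) i = 0" if "l < m" "i < n" for l i
    using that order.strict_trans by blast
  let ?w = "?Q (p m)"
  have A_w: "act n A ?w i = b m m * ?w i" if "i < n" for i
  proof -
    \<comment> \<open>realness of the eigenvalues makes \<open>A\<close> commute with the projection\<close>
    have "hinner ?S (act n A (p m)) (u j) = d j * hinner ?S (p m) (u j)" if "j < k" for j
    proof -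
      have "cnj (d j) = d j"
        using hermitian_eigenvalue_real[OF A, of "u j" "d j"] u ev that
        by (simp add: orthonormal_family_def)
      moreover have "hinner ?S (act n A (p m)) (u j) = hinner ?S (p m) (\<lambda>i. d j * u j i)"
        unfolding hinner_act_left[OF A(1)] A(2) using ev that by (intro hinner_cong) auto
      ultimately show ?thesis by (simp add: hinner_scale_right)
    qed
    then have "act n A ?w i = ?Q (act n A (p m)) i"
      using ev that by (simp add: residual_def act_diff act_sum act_scale) (simp add: mult_ac)
    also have "\<dots> = ?Q (\<lambda>i. \<Sum>l\<le>m. b l m * p l i) i"
      by (rule residual_cong) (use p m(1) that in auto)
    also have "\<dots> = (\<Sum>l\<le>m. b l m * ?Q (p l) i)" by (rule residual_sum)
    also have "\<dots> = b m m * ?w i"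
      using least that by (simp flip: lessThan_Suc_atMost)
    finally show ?thesis .
  qed
  have nz: "sqnorm ?S ?w \<noteq> 0" using m(2) by (auto simp: sqnorm_eq_0)
  show thesis
  proof (rule that[of "normalized ?S ?w" "b m m"])
    show "hinner ?S (normalized ?S ?w) (normalized ?S ?w) = 1"
      using nz by (rule hinner_normalized_self)
    show "hinner ?S (normalized ?S ?w) (u j) = 0" if "j < k" for j
      using that u by (simp add: normalized_def hinner_scale_left residual_orthogonal del: of_real_divide)
    show "act n A (normalized ?S ?w) i = b m m * normalized ?S ?w i" if "i < n" for i
      using that by (simp add: normalized_def act_scale A_w del: of_real_divide)
  qed
qed

lemma hermitian_eigenbasis:
  assumes A: "A \<in> carrier_mat n n" "mat_adjoint A = A"
  obtains u d where "orthonormal_family {..<n} {..<n} u"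
    "\<And>j i. j < n \<Longrightarrow> i < n \<Longrightarrow> act n A (u j) i = d j * u j i"
proof -
  have "\<exists>u d. orthonormal_family {..<n} {..<k} u \<and>
      (\<forall>j<k. \<forall>i<n. act n A (u j) i = d j * u j i)" if "k \<le> n" for k
    using that
  proof (induction k)
    case 0
    then show ?case by (simp add: orthonormal_family_def)
  next
    case (Suc k)
    then obtain u d where u: "orthonormal_family {..<n} {..<k} u"
      and ev: "\<And>j i. j < k \<Longrightarrow> i < n \<Longrightarrow> act n A (u j) i = d j * u j i"
      by auto
    obtain v e where v: "hinner {..<n} v v = 1" "\<And>j. j < k \<Longrightarrow> hinner {..<n} v (u j) = 0"
      and e: "\<And>i. i < n \<Longrightarrow> act n A v i = e * v i"
      using next_orthonormal_eigenvector[OF A _ u ev] Suc.prems by (metis Suc_le_eq)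
    have v': "hinner {..<n} (u j) v = 0" if "j < k" for j
      using v(2)[OF that] cnj_hinner[of "{..<n}" v "u j"] by simp
    have "orthonormal_family {..<n} {..<Suc k} (u(k := v))"
      using u v v' by (auto simp: orthonormal_family_def less_Suc_eq)
    moreover have "\<forall>j<Suc k. \<forall>i<n. act n A ((u(k := v)) j) i = (d(k := e)) j * (u(k := v)) j i"
      using ev e by (auto simp: less_Suc_eq)
    ultimately show ?case by blast
  qed
  then show thesis using that by blast
qed

text \<open>
  A left inverse of a square matrix is a right inverse.
\<close>

lemma orthonormal_basis_complete:
  fixes n :: nat
  assumes u: "orthonormal_family {..<n} {..<n} u" and ij: "i < n" "j < n"
  shows "(\<Sum>k<n. u k i * cnj (u k j)) = of_bool (i = j)"
proof -
  define U where "U = mat n n (\<lambda>(i, k). u k i)"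
  have U: "U \<in> carrier_mat n n" and U_index: "\<And>i k. i < n \<Longrightarrow> k < n \<Longrightarrow> U $$ (i, k) = u k i"
    by (simp_all add: U_def)
  have "mat_adjoint U * U = 1\<^sub>m n"
  proof (rule eq_matI)
    fix k l assume "k < dim_row (1\<^sub>m n)" "l < dim_col (1\<^sub>m n)"
    then have kl: "k < n" "l < n" by simp_all
    have "(mat_adjoint U * U) $$ (k, l) = hinner {..<n} (u l) (u k)"
      using kl U by (simp add: mat_mult_index[OF adjoint_carrier[OF U] U] adjoint_index[OF U]
          hinner_def U_index mult.commute del: index_mult_mat)
    then show "(mat_adjoint U * U) $$ (k, l) = 1\<^sub>m n $$ (k, l)"
      using u kl by (simp add: orthonormal_family_def)
  qed (use U in auto)
  then have "U * mat_adjoint U = 1\<^sub>m n"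
    using U by (metis adjoint_carrier mat_mult_left_right_inverse)
  then have "(U * mat_adjoint U) $$ (i, j) = of_bool (i = j)" using ij by simp
  then show ?thesis
    using ij by (simp add: mat_mult_index[OF U adjoint_carrier[OF U]] adjoint_index[OF U]
        U_index del: index_mult_mat)
qed

lemma spectral_expansion:
  assumes A: "A \<in> carrier_mat n n"
    and u: "orthonormal_family {..<n} {..<n} u"
    and ev: "\<And>k i. k < n \<Longrightarrow> i < n \<Longrightarrow> act n A (u k) i = d k * u k i"
    and ij: "i < n" "j < n"
  shows "A $$ (i, j) = (\<Sum>k<n. d k * u k i * cnj (u k j))"
proof -
  have "A $$ (i, j) = (\<Sum>l<n. A $$ (i, l) * (\<Sum>k<n. u k l * cnj (u k j)))"
  proof -
    have "(\<Sum>l<n. A $$ (i, l) * (\<Sum>k<n. u k l * cnj (u k j))) = (\<Sum>l<n. if l = j then A $$ (i, l) else 0)"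
      using u ij by (intro sum.cong) (auto simp: orthonormal_basis_complete)
    then show ?thesis using ij by simp
  qed
  also have "\<dots> = (\<Sum>k<n. \<Sum>l<n. A $$ (i, l) * u k l * cnj (u k j))"
    unfolding sum_distrib_left mult.assoc by (rule sum.swap)
  also have "\<dots> = (\<Sum>k<n. act n A (u k) i * cnj (u k j))" by (simp add: act_def sum_distrib_right)
  finally show ?thesis using ev ij by simp
qed

text \<open>
  This ties the eigenvalues of the orthonormal eigenbasis, with multiplicities, to the roots of the
  characteristic polynomial, through which the singular values are defined.
\<close>

lemma char_poly_eigenbasis:
  assumes A: "A \<in> carrier_mat n n"
    and u: "orthonormal_family {..<n} {..<n} u"
    and ev: "\<And>k i. k < n \<Longrightarrow> i < n \<Longrightarrow> act n A (u k) i = d k * u k i"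
  shows "proots (char_poly A) = image_mset d (mset_set {..<n})"
proof -
  define U where "U = mat n n (\<lambda>(i, k). u k i)"
  define D where "D = mat n n (\<lambda>(i, k). if i = k then d i else 0)"
  have U: "U \<in> carrier_mat n n" and D: "D \<in> carrier_mat n n"
    and U_index: "\<And>i k. i < n \<Longrightarrow> k < n \<Longrightarrow> U $$ (i, k) = u k i"
    by (simp_all add: U_def D_def)
  have AU: "A * U = U * D"
  proof (rule eq_matI)
    fix i k assume "i < dim_row (U * D)" "k < dim_col (U * D)"
    then have ik: "i < n" "k < n" using U D by auto
    have "(U * D) $$ (i, k) = (\<Sum>l<n. if l = k then u k i * d k else 0)"
      unfolding mat_mult_index[OF U D ik] using ik
      by (intro sum.cong) (auto simp: U_index D_def)
    also have "\<dots> = act n A (u k) i" using ik ev by simp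
    also have "\<dots> = (A * U) $$ (i, k)"
      unfolding mat_mult_index[OF A U ik] using ik by (simp add: act_def U_index)
    finally show "(A * U) $$ (i, k) = (U * D) $$ (i, k)" by simp
  qed (use A U D in auto)
  have "U * mat_adjoint U = 1\<^sub>m n"
  proof (rule eq_matI)
    fix i j assume "i < dim_row (1\<^sub>m n)" "j < dim_col (1\<^sub>m n)"
    then show "(U * mat_adjoint U) $$ (i, j) = 1\<^sub>m n $$ (i, j)"
      using orthonormal_basis_complete[OF u, of i j]
      by (simp add: mat_mult_index[OF U adjoint_carrier[OF U]] adjoint_index[OF U]
        U_index del: index_mult_mat)
  qed (use U in auto)
  moreover from calculation have "mat_adjoint U * U = 1\<^sub>m n"
    using U by (metis adjoint_carrier mat_mult_left_right_inverse)
  moreover have "A = U * D * mat_adjoint U"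
  proof -
    have "U * D * mat_adjoint U = A * (U * mat_adjoint U)"
      unfolding AU[symmetric] using A U adjoint_carrier[OF U] by (simp add: assoc_mult_mat[of _ n n _ n _ n])
    then show ?thesis using A \<open>U * mat_adjoint U = 1\<^sub>m n\<close> by simp
  qed
  ultimately have "similar_mat_wit A D U (mat_adjoint U)"
    by (rule similar_mat_witI) (use A D U in simp_all)
  then have "char_poly A = char_poly D"
    using char_poly_similar similar_mat_def by blast
  also have "\<dots> = (\<Prod>e\<leftarrow>diag_mat D. [:- e, 1:])"
    using D by (intro char_poly_upper_triangular) (auto simp: upper_triangular_def D_def)
  also have "diag_mat D = map d [0..<n]" by (simp add: diag_mat_def D_def)
  finally have "char_poly A = (\<Prod>k<n. [:- d k, 1:])"
    by (simp add: prod.distinct_set_conv_list[symmetric] atLeast0LessThan o_def)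
  then show ?thesis by (simp add: proots_prod image_mset.compositionality sum_unfold_sum_mset)
qed

section \<open>Singular values and the two-vector Ky Fan inequality\<close>

lemma sqnorm_act:
  assumes X: "X \<in> carrier_mat n n"
  shows "complex_of_real (sqnorm {..<n} (act n X v)) = hinner {..<n} v (act n (mat_adjoint X * X) v)"
proof -
  have "complex_of_real (sqnorm {..<n} (act n X v))
      = hinner {..<n} v (act n (mat_adjoint X) (act n X v))"
    by (simp add: hinner_act_left[OF X] flip: hinner_self)
  also have "\<dots> = hinner {..<n} v (act n (mat_adjoint X * X) v)"
    using act_mult[OF adjoint_carrier[OF X] X] by (intro hinner_cong) simp_all
  finally show ?thesis .
qed

lemma sqnorm_act_eigenbasis:
  assumes X: "X \<in> carrier_mat n n"
    and u: "orthonormal_family {..<n} {..<n} u"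
    and ev: "\<And>k i. k < n \<Longrightarrow> i < n \<Longrightarrow>
      act n (mat_adjoint X * X) (u k) i = complex_of_real (r k) * u k i"
  shows "sqnorm {..<n} (act n X v) = (\<Sum>k<n. r k * (cmod (hinner {..<n} v (u k)))\<^sup>2)"
proof -
  let ?A = "mat_adjoint X * X"
  have A: "?A \<in> carrier_mat n n" using X by simp
  have "act n ?A v i = (\<Sum>k<n. (complex_of_real (r k) * hinner {..<n} v (u k)) * u k i)" if "i < n" for i
  proof -
    have "act n ?A v i = (\<Sum>j<n. \<Sum>k<n. complex_of_real (r k) * u k i * cnj (u k j) * v j)"
      using that by (simp add: act_def spectral_expansion[OF A u ev] sum_distrib_right del: index_mult_mat)
    also have "\<dots> = (\<Sum>k<n. \<Sum>j<n. complex_of_real (r k) * u k i * cnj (u k j) * v j)"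
      by (rule sum.swap)
    finally show ?thesis by (simp add: hinner_def sum_distrib_left sum_distrib_right mult_ac)
  qed
  then have "complex_of_real (sqnorm {..<n} (act n X v))
      = hinner {..<n} v (\<lambda>i. \<Sum>k<n. (complex_of_real (r k) * hinner {..<n} v (u k)) * u k i)"
    unfolding sqnorm_act[OF X] by (intro hinner_cong) simp_all
  also have "\<dots> = (\<Sum>k<n. complex_of_real (r k) * (cnj (hinner {..<n} v (u k)) * hinner {..<n} v (u k)))"
    by (simp add: hinner_sum_right hinner_scale_right) (simp add: mult_ac)
  also have "\<dots> = complex_of_real (\<Sum>k<n. r k * (cmod (hinner {..<n} v (u k)))\<^sup>2)"
    by (simp add: complex_norm_square mult.commute del: of_real_power)
  finally show ?thesis using of_real_eq_iff by blast
qed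

lemma trace_eigenbasis:
  assumes A: "A \<in> carrier_mat n n"
    and u: "orthonormal_family {..<n} {..<n} u"
    and ev: "\<And>k i. k < n \<Longrightarrow> i < n \<Longrightarrow> act n A (u k) i = d k * u k i"
  shows "mat_trace A = (\<Sum>k<n. d k)"
proof -
  have "mat_trace A = (\<Sum>i<n. \<Sum>k<n. d k * (u k i * cnj (u k i)))"
    using A by (simp add: mat_trace_def spectral_expansion[OF A u ev] mult.assoc)
  also have "\<dots> = (\<Sum>k<n. \<Sum>i<n. d k * (u k i * cnj (u k i)))" by (rule sum.swap)
  also have "\<dots> = (\<Sum>k<n. d k * hinner {..<n} (u k) (u k))"
    by (simp add: hinner_def sum_distrib_left)
  finally show ?thesis using u by (simp add: orthonormal_family_def)
qed

text \<open>
  The squared singular values \<open>d\<close> in decreasing order, with right singular vectors \<open>u\<close>. The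
  condition on \<open>\<parallel>X v\<parallel>\<^sup>2\<close> is the spectral decomposition of \<open>X\<^sup>* X\<close>, written as a quadratic form.
\<close>

definition singular_system ::
    "nat \<Rightarrow> complex mat \<Rightarrow> (nat \<Rightarrow> nat \<Rightarrow> complex) \<Rightarrow> (nat \<Rightarrow> real) \<Rightarrow> bool" where
  "singular_system n X u d \<longleftrightarrow>
    orthonormal_family {..<n} {..<n} u \<and>
    (\<forall>v. sqnorm {..<n} (act n X v) = (\<Sum>k<n. d k * (cmod (hinner {..<n} v (u k)))\<^sup>2)) \<and>
    (\<forall>k. 0 \<le> d k) \<and>
    (\<forall>k l. k \<le> l \<longrightarrow> l < n \<longrightarrow> d l \<le> d k) \<and>
    (\<forall>k<n. (singular_values X ! k)\<^sup>2 = d k) \<and>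
    (\<Sum>k<n. d k) = (frobenius_norm X)\<^sup>2"

text \<open>
  Take an orthonormal eigenbasis of \<open>X\<^sup>* X\<close>. Its eigenvalues are the squared norms \<open>\<parallel>X u\<^sub>k\<parallel>\<^sup>2\<close>, hence
  nonnegative; sorting them in decreasing order gives the list of squared singular values.
\<close>

lemma singular_system_exists:
  assumes X: "X \<in> carrier_mat n n"
  shows "\<exists>u d. singular_system n X u d"
proof -
  let ?A = "mat_adjoint X * X"
  have A: "?A \<in> carrier_mat n n" using X by simp
  have "mat_adjoint ?A = ?A"
    using X by (simp add: adjoint_mult[OF adjoint_carrier[OF X] X] adjoint_adjoint)
  then obtain u d where u: "orthonormal_family {..<n} {..<n} u"
    and ev: "\<And>k i. k < n \<Longrightarrow> i < n \<Longrightarrow> act n ?A (u k) i = d k * u k i"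
    using hermitian_eigenbasis[OF A] by blast
  \<comment> \<open>the eigenvalues are real and nonnegative because \<open>\<langle>X\<^sup>* X u\<^sub>k, u\<^sub>k\<rangle> = \<parallel>X u\<^sub>k\<parallel>\<^sup>2\<close>\<close>
  define r where "r k = sqnorm {..<n} (act n X (u k))" for k
  have r: "d k = complex_of_real (r k)" if "k < n" for k
  proof -
    have "complex_of_real (r k) = hinner {..<n} (u k) (\<lambda>i. d k * u k i)"
      unfolding r_def sqnorm_act[OF X] using ev that by (intro hinner_cong) simp_all
    then have "complex_of_real (r k) = cnj (d k)"
      using u that by (simp add: hinner_scale_right orthonormal_family_def)
    then show ?thesis by (metis complex_cnj_cnj complex_cnj_complex_of_real)
  qed
  have r_nonneg: "0 \<le> r k" for k by (simp add: r_def sqnorm_nonneg)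
  define js where "js = sort_key r [0..<n]"
  have js: "mset js = mset_set {..<n}" by (simp add: js_def atLeast0LessThan)
  have js_sorted: "sorted (map r js)" by (simp add: js_def)
  have "singular_values X = rev (map (\<lambda>k. sqrt (r k)) js)"
  proof -
    have roots: "proots (char_poly ?A) = image_mset d (mset_set {..<n})"
      by (rule char_poly_eigenbasis[OF A u ev])
    have "image_mset (\<lambda>z. sqrt (Re z)) (proots (char_poly ?A))
        = image_mset (\<lambda>k. sqrt (Re (d k))) (mset_set {..<n})"
      by (simp add: roots image_mset.compositionality o_def)
    also have "\<dots> = image_mset (\<lambda>k. sqrt (r k)) (mset_set {..<n})"
      by (rule image_mset_cong) (simp add: r)
    also have "\<dots> = mset (map (\<lambda>k. sqrt (r k)) js)" by (simp add: js)
    finally have "singular_values X = rev (sort (map (\<lambda>k. sqrt (r k)) js))"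
      by (simp add: singular_values_def del: mset_map)
    moreover have "sorted (map (\<lambda>k. sqrt (r k)) js)"
      using js_sorted by (simp add: sorted_map)
    ultimately show ?thesis by (simp add: sorted_sort_id)
  qed
  define idx where "idx = rev js"
  have idx_len: "length idx = n" and idx_set: "set idx = {..<n}" and idx_dist: "distinct idx"
    by (simp_all add: idx_def js_def atLeast0LessThan)
  have sv: "singular_values X = map (\<lambda>k. sqrt (r k)) idx"
    by (simp add: idx_def rev_map \<open>singular_values X = _\<close>)
  have bij: "bij_betw ((!) idx) {..<n} {..<n}"
    by (rule bij_betw_nth) (simp_all add: idx_dist idx_len idx_set)
  have idx_lt: "idx ! k < n" if "k < n" for k
    using bij that by (auto simp: bij_betw_def)
  let ?u = "\<lambda>k. u (idx ! k)" and ?d = "\<lambda>k. r (idx ! k)"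
  have u': "orthonormal_family {..<n} {..<n} ?u"
    using u idx_lt nth_eq_iff_index_eq[OF idx_dist] by (simp add: orthonormal_family_def idx_len)
  have "singular_system n X ?u ?d"
    unfolding singular_system_def
  proof (intro conjI allI impI)
    show "orthonormal_family {..<n} {..<n} ?u" by (rule u')
    show "sqnorm {..<n} (act n X v) = (\<Sum>k<n. ?d k * (cmod (hinner {..<n} v (?u k)))\<^sup>2)" for v
      using idx_lt by (intro sqnorm_act_eigenbasis[OF X u']) (simp add: ev r)
    show "0 \<le> ?d k" for k by (rule r_nonneg)
    show "?d l \<le> ?d k" if "k \<le> l" "l < n" for k l
    proof -
      have "sorted (rev (map r idx))" using js_sorted by (simp add: idx_def rev_map)
      from sorted_rev_nth_mono[OF this \<open>k \<le> l\<close>] that show ?thesis by (simp add: idx_len)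
    qed
    show "(singular_values X ! k)\<^sup>2 = ?d k" if "k < n" for k
      using that by (simp add: sv idx_len r_nonneg)
    have "(\<Sum>k<n. ?d k) = (\<Sum>k<n. r k)" using bij by (rule sum.reindex_bij_betw)
    moreover have "mat_trace ?A = complex_of_real (\<Sum>k<n. r k)"
    proof -
      have "mat_trace ?A = (\<Sum>k<n. d k)" by (rule trace_eigenbasis[OF A u ev])
      then show ?thesis by (simp add: r)
    qed
    moreover have "mat_trace (X * mat_adjoint X) = mat_trace ?A"
      using X by (intro mat_trace_comm[of _ n]) simp_all
    ultimately show "(\<Sum>k<n. ?d k) = (frobenius_norm X)\<^sup>2"
      by (simp add: frobenius_norm_def sum_nonneg r_nonneg)
  qed
  then show ?thesis by blast
qed

text \<open>
  With total weight 2 and weight at most 1 at the largest coefficient, the best choice is to put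
  weight 1 on each of the two largest.
\<close>

lemma weighted_sum_top_two:
  fixes d p :: "nat \<Rightarrow> real"
  assumes n: "2 \<le> n" and mono: "\<And>k l. k \<le> l \<Longrightarrow> l < n \<Longrightarrow> d l \<le> d k" and d: "\<And>k. 0 \<le> d k"
    and p: "\<And>k. k < n \<Longrightarrow> 0 \<le> p k" "p 0 \<le> 1" and total: "(\<Sum>k<n. p k) \<le> 2"
  shows "(\<Sum>k<n. d k * p k) \<le> d 0 + d 1"
proof -
  have split: "(\<Sum>k<n. f k) = f 0 + (\<Sum>k\<in>{1..<n}. f k)" for f :: "nat \<Rightarrow> real"
    using n by (simp add: lessThan_atLeast0 sum.atLeast_Suc_lessThan)
  have "(\<Sum>k\<in>{1..<n}. d k * p k) \<le> (\<Sum>k\<in>{1..<n}. d 1 * p k)"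
    using mono p by (intro sum_mono mult_right_mono) auto
  also have "\<dots> = d 1 * (\<Sum>k\<in>{1..<n}. p k)" by (simp add: sum_distrib_left)
  also have "\<dots> \<le> d 1 * (2 - p 0)"
    using total d unfolding split[of p] by (intro mult_left_mono) auto
  finally have "(\<Sum>k<n. d k * p k) \<le> d 0 * p 0 + d 1 * (2 - p 0)" unfolding split by simp
  also have "\<dots> = 2 * d 1 + (d 0 - d 1) * p 0" by (simp add: algebra_simps)
  also have "\<dots> \<le> 2 * d 1 + (d 0 - d 1) * 1"
    using mono[of 0 1] n p(2) by (intro add_left_mono mult_left_mono) auto
  finally show ?thesis by simp
qed

lemma norm_2_2_sq:
  assumes "singular_system n X u d" "2 \<le> n"
  shows "(norm_2_2 X)\<^sup>2 = d 0 + d 1"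
proof -
  have "(norm_2_2 X)\<^sup>2 = (singular_values X ! 0)\<^sup>2 + (singular_values X ! 1)\<^sup>2"
    by (simp add: norm_2_2_def singular_value_def)
  then show ?thesis using assms by (simp add: singular_system_def)
qed

text \<open>
  Expanding in right singular vectors, the left-hand side is \<open>\<Sum>k. \<sigma>\<^sub>k\<^sup>2 p\<^sub>k\<close> with weights
  \<open>p\<^sub>k = |\<langle>v, u\<^sub>k\<rangle>|\<^sup>2 + |\<langle>w, u\<^sub>k\<rangle>|\<^sup>2\<close>. Bessel's inequality for the pair \<open>v, w\<close> bounds each weight by 1,
  and Bessel's inequality for the basis \<open>u\<close> bounds the total weight by 2.
\<close>

lemma ky_fan_two:
  assumes X: "X \<in> carrier_mat n n" and n: "2 \<le> n"
    and v: "sqnorm {..<n} v = 1" and w: "sqnorm {..<n} w = 1" and vw: "hinner {..<n} v w = 0"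
  shows "sqnorm {..<n} (act n X v) + sqnorm {..<n} (act n X w) \<le> (norm_2_2 X)\<^sup>2"
proof -
  obtain u d where sys: "singular_system n X u d" using singular_system_exists[OF X] by blast
  then have u: "orthonormal_family {..<n} {..<n} u"
    and eq: "\<And>v. sqnorm {..<n} (act n X v) = (\<Sum>k<n. d k * (cmod (hinner {..<n} v (u k)))\<^sup>2)"
    and d: "\<And>k. 0 \<le> d k" "\<And>k l. k \<le> l \<Longrightarrow> l < n \<Longrightarrow> d l \<le> d k"
    by (simp_all add: singular_system_def)
  define p where "p k = (cmod (hinner {..<n} v (u k)))\<^sup>2 + (cmod (hinner {..<n} w (u k)))\<^sup>2" for k
  have wv: "hinner {..<n} w v = 0" using cnj_hinner[of "{..<n}" v w] vw by simp
  have on: "orthonormal_family {..<n} UNIV (\<lambda>b. if b then v else w)"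
    using v w vw wv by (auto simp: orthonormal_family_def hinner_self)
  have "sqnorm {..<n} (u 0) = 1"
  proof -
    have "complex_of_real (sqnorm {..<n} (u 0)) = 1"
      using u n by (simp add: orthonormal_family_def flip: hinner_self)
    then show ?thesis by simp
  qed
  moreover have "cmod (hinner {..<n} (u 0) x) = cmod (hinner {..<n} x (u 0))" for x
    by (metis cnj_hinner complex_mod_cnj)
  ultimately have "p 0 \<le> 1"
    using bessel[OF _ on, of "u 0"] by (simp add: p_def UNIV_bool)
  moreover have "(\<Sum>k<n. p k) \<le> 2"
    using bessel[OF _ u, of v] bessel[OF _ u, of w] v w by (simp add: p_def sum.distrib)
  ultimately have "(\<Sum>k<n. d k * p k) \<le> d 0 + d 1"
    using n d by (intro weighted_sum_top_two) (auto simp: p_def)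
  then show ?thesis
    by (simp add: eq norm_2_2_sq[OF sys n] p_def distrib_left sum.distrib)
qed

lemma sqnorm_act_le:
  assumes X: "X \<in> carrier_mat n n" and n: "2 \<le> n" and v: "sqnorm {..<n} v = 1"
  shows "sqnorm {..<n} (act n X v) \<le> (norm_2_2 X)\<^sup>2"
proof -
  obtain u d where sys: "singular_system n X u d" using singular_system_exists[OF X] by blast
  then have u: "orthonormal_family {..<n} {..<n} u"
    and eq: "\<And>v. sqnorm {..<n} (act n X v) = (\<Sum>k<n. d k * (cmod (hinner {..<n} v (u k)))\<^sup>2)"
    and d: "\<And>k. 0 \<le> d k" "\<And>k l. k \<le> l \<Longrightarrow> l < n \<Longrightarrow> d l \<le> d k"
    by (simp_all add: singular_system_def)
  have "sqnorm {..<n} (act n X v) \<le> (\<Sum>k<n. d 0 * (cmod (hinner {..<n} v (u k)))\<^sup>2)"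
    unfolding eq using d(2) by (intro sum_mono mult_right_mono) auto
  also have "\<dots> \<le> d 0 * 1"
    unfolding sum_distrib_left[symmetric] using bessel[OF _ u, of v] v d(1) by (intro mult_left_mono) auto
  finally show ?thesis using d(1)[of 1] by (simp add: norm_2_2_sq[OF sys n])
qed


text \<open>
  The squares of all singular values add up to the squared Frobenius norm.
\<close>

lemma norm_2_2_le_frobenius:
  assumes X: "X \<in> carrier_mat n n" and n: "2 \<le> n"
  shows "(norm_2_2 X)\<^sup>2 \<le> (frobenius_norm X)\<^sup>2"
proof -
  obtain u d where sys: "singular_system n X u d" using singular_system_exists[OF X] by blast
  then have d: "\<And>k. 0 \<le> d k" "(\<Sum>k<n. d k) = (frobenius_norm X)\<^sup>2"
    by (simp_all add: singular_system_def)
  have "(\<Sum>k\<in>{0, 1}. d k) \<le> (\<Sum>k<n. d k)" using n d(1) by (intro sum_mono2) auto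
  then show ?thesis by (simp add: norm_2_2_sq[OF sys n] d(2))
qed

section \<open>Variance bound for a single vector\<close>

text \<open>
  Let \<open>y\<close> be the component of \<open>X\<^sup>* v\<close> orthogonal to \<open>v\<close>; the component along \<open>v\<close> accounts for the
  second summand on the right. If \<open>y \<noteq> 0\<close> and \<open>w = y / \<parallel>y\<parallel>\<close>, then
  \<open>\<parallel>y\<parallel> = \<langle>w, X\<^sup>* v\<rangle> = \<langle>X w, v\<rangle> \<le> \<parallel>X w\<parallel>\<close>, and Ky Fan's inequality applies to \<open>v\<close> and \<open>w\<close>.
\<close>

lemma pure_state_bound:
  assumes X: "X \<in> carrier_mat n n" and n: "2 \<le> n" and v: "sqnorm {..<n} v = 1"
  shows "sqnorm {..<n} (act n X v) + sqnorm {..<n} (act n (mat_adjoint X) v)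
    \<le> (norm_2_2 X)\<^sup>2 + (cmod (hinner {..<n} (act n X v) v))\<^sup>2"
proof -
  let ?S = "{..<n}"
  define a where "a = act n (mat_adjoint X) v"
  define y where "y = residual ?S {()} (\<lambda>_. v) a"
  have on: "orthonormal_family ?S {()} (\<lambda>_. v)"
    using v by (simp add: orthonormal_family_def hinner_self)
  have "hinner ?S a v = cnj (hinner ?S (act n X v) v)"
    unfolding hinner_act_left[OF X] a_def cnj_hinner ..
  then have split: "sqnorm ?S a = sqnorm ?S y + (cmod (hinner ?S (act n X v) v))\<^sup>2"
    using sqnorm_residual[OF _ on, of a] by (simp add: y_def)
  have yv: "hinner ?S y v = 0"
    unfolding y_def using residual_orthogonal[OF _ on] by simp
  show ?thesis
  proof (cases "sqnorm ?S y = 0")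
    case True
    then show ?thesis using split sqnorm_act_le[OF X n v] by (simp add: a_def)
  next
    case False
    define w where "w = normalized ?S y"
    have w: "sqnorm ?S w = 1" unfolding w_def using False by (rule sqnorm_normalized)
    have wv: "hinner ?S w v = 0" using yv by (simp add: w_def normalized_def hinner_scale_left del: of_real_divide)
    then have vw: "hinner ?S v w = 0" using cnj_hinner[of ?S w v] by simp
    have "hinner ?S (act n X w) v = hinner ?S w a" by (simp add: hinner_act_left[OF X] a_def)
    also have "\<dots> = hinner ?S w y"
      using wv by (simp add: y_def residual_def hinner_diff_right hinner_scale_right)
    also have "\<dots> = complex_of_real (sqrt (sqnorm ?S y))"
    proof -
      have "hinner ?S w y = complex_of_real (1 / sqrt (sqnorm ?S y) * sqnorm ?S y)"
        by (simp only: w_def normalized_def hinner_scale_left hinner_self of_real_mult)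
      also have "1 / sqrt (sqnorm ?S y) * sqnorm ?S y = sqrt (sqnorm ?S y)"
        using real_div_sqrt[OF sqnorm_nonneg[of ?S y]] by simp
      finally show ?thesis .
    qed
    finally have "sqnorm ?S y = (cmod (hinner ?S (act n X w) v))\<^sup>2"
      by (simp add: sqnorm_nonneg)
    also have "\<dots> \<le> sqnorm ?S (act n X w)"
      using cauchy_schwarz[of ?S "act n X w" v] v by simp
    finally show ?thesis
      using split ky_fan_two[OF X n v w vw] by (simp add: a_def)
  qed
qed

text \<open>
  The previous bound rescaled to vectors of arbitrary length. For vectors with the same mean \<open>c\<close>, both
  sides are additive in \<open>v v\<^sup>*\<close>, which is what makes the sum over a decomposition possible.
\<close>

lemma vector_bound:
  assumes X: "X \<in> carrier_mat n n" and n: "2 \<le> n"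
    and c: "hinner {..<n} (act n X v) v = c * complex_of_real (sqnorm {..<n} v)"
  shows "sqnorm {..<n} (act n X v) + sqnorm {..<n} (act n (mat_adjoint X) v)
    \<le> ((norm_2_2 X)\<^sup>2 + (cmod c)\<^sup>2) * sqnorm {..<n} v"
proof (cases "sqnorm {..<n} v = 0")
  case True
  then have "\<And>i. i < n \<Longrightarrow> v i = 0" by (simp add: sqnorm_eq_0)
  then have "act n Z v = (\<lambda>_. 0)" for Z by (simp add: act_def)
  then show ?thesis using True by (simp add: sqnorm_def)
next
  case False
  let ?S = "{..<n}"
  define N where "N = sqnorm ?S v"
  have N: "0 < N" using False sqnorm_nonneg[of ?S v] by (simp add: N_def)
  define z where "z = complex_of_real (1 / sqrt N)"
  have z: "(cmod z)\<^sup>2 = 1 / N" "z * cnj z = complex_of_real (1 / N)"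
    using N by (simp_all add: z_def norm_divide power_divide flip: of_real_mult of_real_divide)
  have nv: "normalized ?S v = (\<lambda>i. z * v i)" by (simp add: normalized_def z_def N_def)
  have "hinner ?S (act n X (normalized ?S v)) (normalized ?S v) = z * cnj z * (c * complex_of_real N)"
    by (simp add: nv act_scale hinner_scale_left hinner_scale_right c N_def)
  also have "\<dots> = c" using N by (simp add: z)
  finally have "hinner ?S (act n X (normalized ?S v)) (normalized ?S v) = c" .
  with pure_state_bound[OF X n sqnorm_normalized[OF False]]
  have "1 / N * sqnorm ?S (act n X v) + 1 / N * sqnorm ?S (act n (mat_adjoint X) v)
      \<le> (norm_2_2 X)\<^sup>2 + (cmod c)\<^sup>2"
    by (simp add: nv act_scale sqnorm_scale z)
  then show ?thesis using N by (simp add: N_def[symmetric] field_simps)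
qed

section \<open>Families of vectors with the same density matrix\<close>

definition qform :: "nat \<Rightarrow> (nat \<Rightarrow> nat \<Rightarrow> complex) \<Rightarrow> (nat \<Rightarrow> complex) \<Rightarrow> (nat \<Rightarrow> complex) \<Rightarrow> complex"
  where "qform n M u w = (\<Sum>i<n. \<Sum>j<n. M i j * (u j * cnj (w i)))"

text \<open>
  Both families give the same matrix \<open>\<Sum>k. v\<^sub>k v\<^sub>k\<^sup>*\<close>, so all sums of quadratic forms over them agree.
\<close>

definition same_density :: "nat \<Rightarrow> (nat \<Rightarrow> nat \<Rightarrow> complex) \<Rightarrow> (nat \<Rightarrow> nat \<Rightarrow> complex) \<Rightarrow> bool"
  where "same_density m v w \<longleftrightarrow>
    (\<forall>i j. (\<Sum>k<m. w k i * cnj (w k j)) = (\<Sum>k<m. v k i * cnj (v k j)))"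

lemma qform_sum_density:
  "(\<Sum>k<m. qform n M (v k) (v k)) = (\<Sum>i<n. \<Sum>j<n. M i j * (\<Sum>k<m. v k j * cnj (v k i)))"
proof -
  have "(\<Sum>k<m. qform n M (v k) (v k)) = (\<Sum>i<n. \<Sum>k<m. \<Sum>j<n. M i j * (v k j * cnj (v k i)))"
    unfolding qform_def by (rule sum.swap)
  also have "\<dots> = (\<Sum>i<n. \<Sum>j<n. \<Sum>k<m. M i j * (v k j * cnj (v k i)))"
    by (intro sum.cong refl sum.swap)
  finally show ?thesis by (simp add: sum_distrib_left)
qed

lemma same_density_qform:
  "same_density m v w \<Longrightarrow> (\<Sum>k<m. qform n M (w k) (w k)) = (\<Sum>k<m. qform n M (v k) (v k))"
  by (simp add: qform_sum_density same_density_def)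

lemma qform_combine:
  "qform n M (\<lambda>i. a * u i + b * v i) (\<lambda>i. a * u i + b * v i)
   = a * cnj a * qform n M u u + b * cnj b * qform n M v v
     + (b * cnj a * qform n M v u + a * cnj b * qform n M u v)"
proof -
  have "M i j * ((a * u j + b * v j) * cnj (a * u i + b * v i))
      = a * cnj a * (M i j * (u j * cnj (u i))) + b * cnj b * (M i j * (v j * cnj (v i)))
        + (b * cnj a * (M i j * (v j * cnj (u i))) + a * cnj b * (M i j * (u j * cnj (v i))))" for i j
    by (simp add: algebra_simps)
  then show ?thesis by (simp only: qform_def sum.distrib sum_distrib_left)
qed

text \<open>
  The imaginary part is a real linear function of \<open>(Re e, Im e)\<close>, so it vanishes at least on
  a line through the origin, and such a line meets the unit circle.
\<close>

lemma phase_making_real: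
  fixes a b :: complex
  obtains e where "cmod e = 1" "Im (e * a + cnj e * b) = 0"
proof -
  \<comment> \<open>for \<open>e = x + i y\<close> the imaginary part is \<open>(Im a + Im b) x + (Re a - Re b) y\<close>\<close>
  define z where "z = Complex (Re a - Re b) (- (Im a + Im b))"
  have z: "Im (z * a + cnj z * b) = 0" by (simp add: z_def algebra_simps)
  show thesis
  proof (cases "z = 0")
    case True
    then have "Im a + Im b = 0" by (simp add: z_def complex_eq_iff)
    then show thesis using that[of 1] by simp
  next
    case False
    have "sgn z * a + cnj (sgn z) * b = (z * a + cnj z * b) / complex_of_real (cmod z)"
      by (simp add: sgn_eq add_divide_distrib)
    then have "Im (sgn z * a + cnj (sgn z) * b) = 0" using z by simp
    then show thesis using that[of "sgn z"] False by (simp add: norm_sgn)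
  qed
qed

text \<open>
  This is the convexity argument of the Toeplitz-Hausdorff theorem. Replacing \<open>(u, v)\<close> by
  \<open>(cos \<theta> u + e sin \<theta> v, - e\<^sup>* sin \<theta> u + cos \<theta> v)\<close> with \<open>|e| = 1\<close> is a unitary mixing and so keeps
  \<open>u u\<^sup>* + v v\<^sup>*\<close>. The phase \<open>e\<close> is chosen such that the mixed terms are a real multiple of
  \<open>D = q(v) - q(u)\<close>; then \<open>q\<close> of the first vector moves along the line from \<open>q(u)\<close> to \<open>q(v)\<close> as \<open>\<theta>\<close>
  goes from \<open>0\<close> to \<open>\<pi>/2\<close>, and the intermediate value theorem provides \<open>\<theta>\<close>.
\<close>

lemma rotate_pair_to_segment:
  assumes t: "0 \<le> t" "t \<le> 1"
  obtains u' v' where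
    "\<forall>i j. u' i * cnj (u' j) + v' i * cnj (v' j) = u i * cnj (u j) + v i * cnj (v j)"
    "qform n M u' u' = qform n M u u + complex_of_real t * (qform n M v v - qform n M u u)"
proof (cases "qform n M u u = qform n M v v")
  case True
  then show thesis using that[of u v] by simp
next
  case False
  define D where "D = qform n M v v - qform n M u u"
  have D: "D \<noteq> 0" using False by (simp add: D_def)
  obtain e where e: "cmod e = 1"
    and Im0: "Im (e * (qform n M v u / D) + cnj e * (qform n M u v / D)) = 0"
    using phase_making_real .
  define K where "K = Re (e * (qform n M v u / D) + cnj e * (qform n M u v / D))"
  have "e * (qform n M v u / D) + cnj e * (qform n M u v / D) = complex_of_real K"
    using Im0 by (simp add: K_def complex_eq_iff)
  then have K: "e * qform n M v u + cnj e * qform n M u v = D * complex_of_real K"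
    using D by (simp add: field_simps)
  \<comment> \<open>the position of \<open>q\<close> of the rotated vector on the line, relative to the segment\<close>
  define f where "f \<theta> = (sin \<theta>)\<^sup>2 + sin \<theta> * cos \<theta> * K" for \<theta> :: real
  have "\<exists>\<theta>\<ge>0. \<theta> \<le> pi / 2 \<and> f \<theta> = t"
    by (rule IVT') (use t in \<open>auto simp: f_def intro!: continuous_intros\<close>)
  then obtain \<theta> where \<theta>: "f \<theta> = t" by blast
  define c s where "c = complex_of_real (cos \<theta>)" and "s = complex_of_real (sin \<theta>)"
  have cs: "c * c + s * s = 1"
    unfolding c_def s_def by (metis of_real_1 of_real_add of_real_mult power2_eq_square sin_cos_squared_add2)
  have real: "cnj c = c" "cnj s = s" by (simp_all add: c_def s_def)
  have ee: "e * cnj e = 1" using e by (simp add: complex_norm_square[symmetric])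
  let ?u' = "\<lambda>i. c * u i + s * e * v i" and ?v' = "\<lambda>i. - (s * cnj e) * u i + c * v i"
  show thesis
  proof (rule that, intro allI)
    fix i j
    have "?u' i * cnj (?u' j) + ?v' i * cnj (?v' j)
        = (c * c + s * s * (e * cnj e)) * (u i * cnj (u j))
          + (c * c + s * s * (e * cnj e)) * (v i * cnj (v j))"
      by (simp add: real algebra_simps)
    then show "?u' i * cnj (?u' j) + ?v' i * cnj (?v' j) = u i * cnj (u j) + v i * cnj (v j)"
      by (simp add: ee cs)
  next
    have "qform n M ?u' ?u' = c * c * qform n M u u + s * s * (e * cnj e) * qform n M v v
        + c * s * (e * qform n M v u + cnj e * qform n M u v)"
      unfolding qform_combine by (simp add: real algebra_simps)
    also have "\<dots> = (c * c + s * s) * qform n M u u + (s * s + s * c * complex_of_real K) * D"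
      by (simp only: ee K) (simp add: D_def algebra_simps)
    also have "s * s + s * c * complex_of_real K = complex_of_real t"
      by (simp add: \<theta>[symmetric] f_def c_def s_def power2_eq_square)
    finally show "qform n M ?u' ?u' = qform n M u u + complex_of_real t * (qform n M v v - qform n M u u)"
      by (simp add: cs D_def)
  qed
qed

lemma same_density_refl: "same_density m v v"
  by (simp add: same_density_def)

lemma same_density_trans: "same_density m u v \<Longrightarrow> same_density m v w \<Longrightarrow> same_density m u w"
  unfolding same_density_def by metis

lemma same_density_extend:
  "same_density m v w \<Longrightarrow> same_density (Suc m) v (w(m := v m))"
  unfolding same_density_def by simp

text \<open>
  The running means of the values \<open>q(v\<^sub>k)\<close> are produced one after the other: the mean of \<open>m + 2\<close>
  values lies on the segment between the last value and the mean of the first \<open>m + 1\<close>, so one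
  rotation of two vectors suffices in each step.
\<close>

lemma move_mean_to_last:
  "\<exists>w. same_density (Suc m) v w \<and>
     of_nat (Suc m) * qform n M (w m) (w m) = (\<Sum>k<Suc m. qform n M (v k) (v k))"
proof (induction m)
  case 0
  have "of_nat (Suc 0) * qform n M (v 0) (v 0) = (\<Sum>k<Suc 0. qform n M (v k) (v k))" by simp
  with same_density_refl show ?case by blast
next
  case (Suc m)
  then obtain w where w: "same_density (Suc m) v w"
    and mean: "of_nat (Suc m) * qform n M (w m) (w m) = (\<Sum>k<Suc m. qform n M (v k) (v k))"
    by blast
  \<comment> \<open>the weight of the old mean in the new one\<close>
  let ?t = "real (Suc m) / real (Suc (Suc m))"
  have t: "0 \<le> ?t" "?t \<le> 1" by simp_all
  obtain a b where
    ab: "\<forall>i j. a i * cnj (a j) + b i * cnj (b j)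
      = v (Suc m) i * cnj (v (Suc m) j) + w m i * cnj (w m j)" and
    a: "qform n M a a = qform n M (v (Suc m)) (v (Suc m))
      + complex_of_real ?t * (qform n M (w m) (w m) - qform n M (v (Suc m)) (v (Suc m)))"
    using rotate_pair_to_segment[OF t, of "v (Suc m)" "w m" n M] .
  let ?w = "w(m := b, Suc m := a)"
  have "same_density (Suc (Suc m)) v ?w"
    unfolding same_density_def
  proof (intro allI)
    fix i j
    have "(\<Sum>k<Suc (Suc m). ?w k i * cnj (?w k j))
        = (\<Sum>k<m. w k i * cnj (w k j)) + (a i * cnj (a j) + b i * cnj (b j))"
      by simp
    also have "\<dots> = (\<Sum>k<Suc m. w k i * cnj (w k j)) + v (Suc m) i * cnj (v (Suc m) j)"
      using ab by simp
    also have "(\<Sum>k<Suc m. w k i * cnj (w k j)) = (\<Sum>k<Suc m. v k i * cnj (v k j))"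
      using w unfolding same_density_def by blast
    finally show "(\<Sum>k<Suc (Suc m). ?w k i * cnj (?w k j))
        = (\<Sum>k<Suc (Suc m). v k i * cnj (v k j))"
      unfolding sum.lessThan_Suc[of _ "Suc m"] .
  qed
  moreover have "of_nat (Suc (Suc m)) * qform n M a a
      = of_nat (Suc m) * qform n M (w m) (w m) + qform n M (v (Suc m)) (v (Suc m))"
  proof -
    have "real (Suc (Suc m)) * ?t = real (Suc m)" by (simp del: of_nat_Suc)
    then have N1: "complex_of_nat (Suc (Suc m)) * complex_of_real ?t = of_nat (Suc m)"
      by (metis of_real_mult of_real_of_nat_eq)
    have N2: "of_nat (Suc (Suc m)) = (of_nat (Suc m) + 1 :: complex)" by simp
    have "of_nat (Suc (Suc m)) * qform n M a a
      = of_nat (Suc (Suc m)) * qform n M (v (Suc m)) (v (Suc m))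
        + of_nat (Suc (Suc m)) * complex_of_real ?t * (qform n M (w m) (w m) - qform n M (v (Suc m)) (v (Suc m)))"
      unfolding a by (simp only: distrib_left mult.assoc)
    then show ?thesis unfolding N1 unfolding N2 by (simp add: algebra_simps)
  qed
  then have "of_nat (Suc (Suc m)) * qform n M (?w (Suc m)) (?w (Suc m))
      = (\<Sum>k<Suc (Suc m). qform n M (v k) (v k))"
    unfolding mean by simp
  ultimately show ?case by (intro exI[of _ ?w] conjI)
qed

text \<open>
  If the values add up to zero, so does their mean. Move it to the last vector and continue with the
  others, whose values still add up to zero.
\<close>

lemma zero_diagonal_decomposition:
  assumes "(\<Sum>k<m. qform n M (v k) (v k)) = 0"
  shows "\<exists>w. same_density m v w \<and> (\<forall>k<m. qform n M (w k) (w k) = 0)"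
  using assms
proof (induction m arbitrary: v)
  case 0
  show ?case by (simp add: same_density_def)
next
  case (Suc m)
  obtain w where w: "same_density (Suc m) v w"
    and "of_nat (Suc m) * qform n M (w m) (w m) = (\<Sum>k<Suc m. qform n M (v k) (v k))"
    using move_mean_to_last by blast
  then have last: "qform n M (w m) (w m) = 0"
    using Suc.prems of_nat_neq_0[of m, where 'a = complex] by (simp del: of_nat_Suc)
  have "(\<Sum>k<m. qform n M (w k) (w k)) = 0"
    using same_density_qform[OF w, of n M] Suc.prems last by simp
  then obtain w' where w': "same_density m w w'" and zero: "\<And>k. k < m \<Longrightarrow> qform n M (w' k) (w' k) = 0"
    using Suc.IH by blast
  have "same_density (Suc m) v (w'(m := w m))"
    using same_density_trans[OF w same_density_extend[OF w']] .
  moreover have "\<forall>k<Suc m. qform n M ((w'(m := w m)) k) ((w'(m := w m)) k) = 0"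
    using zero last by (auto simp: less_Suc_eq)
  ultimately show ?case by blast
qed

section \<open>Variance bound for density matrices\<close>

lemma qform_mat: "qform n (\<lambda>i j. A $$ (i, j)) u w = hinner {..<n} (act n A u) w"
  by (simp add: qform_def hinner_def act_def sum_distrib_right mult.assoc)

text \<open>
  This is the quadratic form of \<open>A - c I\<close>; it vanishes at a nonzero vector exactly when the mean of
  \<open>A\<close> there is \<open>c\<close>.
\<close>

lemma qform_shifted:
  "qform n (\<lambda>i j. A $$ (i, j) - c * of_bool (i = j)) u u
    = hinner {..<n} (act n A u) u - c * complex_of_real (sqnorm {..<n} u)"
proof -
  have "(\<Sum>j<n. c * of_bool (i = j) * (u j * cnj (u i))) = c * (u i * cnj (u i))" if "i < n" for i
  proof -
    have "(\<Sum>j<n. c * of_bool (i = j) * (u j * cnj (u i)))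
        = (\<Sum>j<n. if j = i then c * (u i * cnj (u i)) else 0)"
      by (intro sum.cong) auto
    then show ?thesis using that by simp
  qed
  then show ?thesis
    unfolding qform_mat[symmetric] hinner_self[symmetric]
    by (simp add: qform_def hinner_def left_diff_distrib sum_subtractf sum_distrib_left)
qed

lemma sum_sqnorm_act_same_density:
  assumes X: "X \<in> carrier_mat n n" and vw: "same_density m v w"
  shows "(\<Sum>k<m. sqnorm {..<n} (act n X (w k))) = (\<Sum>k<m. sqnorm {..<n} (act n X (v k)))"
proof -
  have q: "complex_of_real (sqnorm {..<n} (act n X u))
      = qform n (\<lambda>i j. (mat_adjoint X * X) $$ (i, j)) u u" for u
  proof -
    have "complex_of_real (sqnorm {..<n} (act n X u)) = cnj (hinner {..<n} u (act n (mat_adjoint X * X) u))"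
      by (simp add: sqnorm_act[OF X, symmetric])
    then show ?thesis by (simp add: cnj_hinner qform_mat)
  qed
  have "complex_of_real (\<Sum>k<m. sqnorm {..<n} (act n X (w k)))
      = complex_of_real (\<Sum>k<m. sqnorm {..<n} (act n X (v k)))"
    unfolding of_real_sum q by (rule same_density_qform[OF vw])
  then show ?thesis using of_real_eq_iff by blast
qed

lemma sum_sqnorm_same_density:
  assumes vw: "same_density m v w"
  shows "(\<Sum>k<m. sqnorm {..<n} (w k)) = (\<Sum>k<m. sqnorm {..<n} (v k))"
proof -
  have act1: "act n (1\<^sub>m n) u i = u i" if "i < n" for u i
  proof -
    have "act n (1\<^sub>m n) u i = (\<Sum>j<n. if j = i then u i else 0)"
      unfolding act_def using that by (intro sum.cong) auto
    then show ?thesis using that by simp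
  qed
  have "sqnorm {..<n} (act n (1\<^sub>m n) u) = sqnorm {..<n} u" for u
    by (intro sqnorm_cong) (simp add: act1)
  then show ?thesis using sum_sqnorm_act_same_density[OF one_carrier_mat vw, of n] by simp
qed

text \<open>
  In terms of \<open>\<rho> = \<Sum>k. v\<^sub>k v\<^sub>k\<^sup>*\<close> with trace \<open>N\<close>, this is
  \<open>Tr \<rho> (X\<^sup>* X + X X\<^sup>*) \<le> B N + |Tr \<rho> X|\<^sup>2 / N\<close>. The left-hand side depends only on \<open>\<rho>\<close>, so the \<open>v\<^sub>k\<close>
  can be replaced by vectors \<open>w\<close> with \<open>\<langle>X w, w\<rangle> = c \<parallel>w\<parallel>\<^sup>2\<close> for \<open>c = Tr \<rho> X / N\<close>, and the
  bound for single vectors can be summed.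
\<close>

lemma density_variance_bound:
  fixes m :: nat
  assumes X: "X \<in> carrier_mat n n" and n: "2 \<le> n"
    and N: "(\<Sum>k<m. sqnorm {..<n} (v k)) = N" and "0 < N"
  shows "(\<Sum>k<m. sqnorm {..<n} (act n X (v k)) + sqnorm {..<n} (act n (mat_adjoint X) (v k)))
    \<le> (norm_2_2 X)\<^sup>2 * N + (cmod (\<Sum>k<m. hinner {..<n} (act n X (v k)) (v k)))\<^sup>2 / N"
proof -
  let ?S = "{..<n}" and ?X' = "mat_adjoint X"
  define s where "s = (\<Sum>k<m. hinner ?S (act n X (v k)) (v k))"
  \<comment> \<open>the mean of \<open>X\<close> in the state \<open>\<rho> / N\<close>\<close>
  define c where "c = s / complex_of_real N"
  let ?M = "\<lambda>i j. X $$ (i, j) - c * of_bool (i = j)"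
  have "(\<Sum>k<m. qform n ?M (v k) (v k)) = s - c * complex_of_real (\<Sum>k<m. sqnorm ?S (v k))"
    by (simp add: qform_shifted sum_subtractf s_def sum_distrib_left)
  also have "\<dots> = 0" using \<open>0 < N\<close> by (simp add: N c_def)
  finally obtain w where w: "same_density m v w" and zero: "\<forall>k<m. qform n ?M (w k) (w k) = 0"
    using zero_diagonal_decomposition by blast
  have "(\<Sum>k<m. sqnorm ?S (act n X (v k)) + sqnorm ?S (act n ?X' (v k)))
      = (\<Sum>k<m. sqnorm ?S (act n X (w k)) + sqnorm ?S (act n ?X' (w k)))"
    using sum_sqnorm_act_same_density[OF X w] sum_sqnorm_act_same_density[OF adjoint_carrier[OF X] w]
    by (simp add: sum.distrib)
  also have "\<dots> \<le> (\<Sum>k<m. ((norm_2_2 X)\<^sup>2 + (cmod c)\<^sup>2) * sqnorm ?S (w k))"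
    using zero by (intro sum_mono vector_bound[OF X n]) (simp add: qform_shifted)
  also have "\<dots> = ((norm_2_2 X)\<^sup>2 + (cmod c)\<^sup>2) * N"
    by (simp add: sum_sqnorm_same_density[OF w] N flip: sum_distrib_left)
  also have "\<dots> = (norm_2_2 X)\<^sup>2 * N + (cmod s)\<^sup>2 / N"
    using \<open>0 < N\<close> by (simp add: c_def norm_divide power_divide field_simps power2_eq_square)
  finally show ?thesis by (simp add: s_def)
qed

section \<open>The Frobenius inner product\<close>

definition frob :: "nat \<Rightarrow> complex mat \<Rightarrow> complex mat \<Rightarrow> complex" where
  "frob n A B = hinner ({..<n} \<times> {..<n}) (($$) A) (($$) B)"

definition frob_sq :: "nat \<Rightarrow> complex mat \<Rightarrow> real" where
  "frob_sq n A = sqnorm ({..<n} \<times> {..<n}) (($$) A)"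

lemma frob_self: "frob n A A = complex_of_real (frob_sq n A)"
  by (simp add: frob_def frob_sq_def hinner_self)

lemma cnj_frob: "cnj (frob n A B) = frob n B A"
  by (simp add: frob_def cnj_hinner)

lemma frob_cols: "frob n A B = (\<Sum>j<n. hinner {..<n} (\<lambda>i. A $$ (i, j)) (\<lambda>i. B $$ (i, j)))"
proof -
  have "frob n A B = (\<Sum>i<n. \<Sum>j<n. A $$ (i, j) * cnj (B $$ (i, j)))"
    by (simp add: frob_def hinner_def sum.cartesian_product)
  also have "\<dots> = (\<Sum>j<n. \<Sum>i<n. A $$ (i, j) * cnj (B $$ (i, j)))" by (rule sum.swap)
  finally show ?thesis by (simp add: hinner_def)
qed

lemma frob_trace:
  assumes A: "A \<in> carrier_mat n n" and B: "B \<in> carrier_mat n n"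
  shows "frob n A B = mat_trace (A * mat_adjoint B)"
  unfolding mat_trace_mult[OF A adjoint_carrier[OF B]] using B
  by (simp add: frob_def hinner_def sum.cartesian_product)

lemma frob_sq_pos:
  assumes "A \<in> carrier_mat n n" "A \<noteq> 0\<^sub>m n n"
  shows "0 < frob_sq n A"
proof -
  have "frob_sq n A \<noteq> 0"
  proof
    assume "frob_sq n A = 0"
    then have "\<And>i j. i < n \<Longrightarrow> j < n \<Longrightarrow> A $$ (i, j) = 0" by (simp add: frob_sq_def sqnorm_eq_0)
    then have "A = 0\<^sub>m n n" using assms(1) by (intro eq_matI) auto
    then show False using assms(2) by simp
  qed
  then show ?thesis using sqnorm_nonneg[of _ "($$) A"] by (simp add: frob_sq_def order.not_eq_order_implies_strict)
qed

lemma frob_add_left: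
  assumes "A \<in> carrier_mat n n" "B \<in> carrier_mat n n"
  shows "frob n (A + B) C = frob n A C + frob n B C"
proof -
  have "frob n (A + B) C = (\<Sum>p\<in>{..<n} \<times> {..<n}. (A $$ p + B $$ p) * cnj (C $$ p))"
    using assms unfolding frob_def hinner_def by (intro sum.cong) auto
  then show ?thesis by (simp add: frob_def hinner_def distrib_right sum.distrib)
qed

lemma frob_diff_left:
  assumes "A \<in> carrier_mat n n" "B \<in> carrier_mat n n"
  shows "frob n (A - B) C = frob n A C - frob n B C"
proof -
  have "frob n (A - B) C = (\<Sum>p\<in>{..<n} \<times> {..<n}. (A $$ p - B $$ p) * cnj (C $$ p))"
    using assms unfolding frob_def hinner_def by (intro sum.cong) auto
  then show ?thesis by (simp add: frob_def hinner_def left_diff_distrib sum_subtractf)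
qed

lemma frob_smult_left:
  assumes "A \<in> carrier_mat n n"
  shows "frob n (c \<cdot>\<^sub>m A) C = c * frob n A C"
proof -
  have "frob n (c \<cdot>\<^sub>m A) C = (\<Sum>p\<in>{..<n} \<times> {..<n}. c * (A $$ p * cnj (C $$ p)))"
    using assms unfolding frob_def hinner_def by (intro sum.cong) auto
  then show ?thesis by (simp add: frob_def hinner_def sum_distrib_left)
qed

lemma frob_mult_left:
  assumes A: "A \<in> carrier_mat n n" and B: "B \<in> carrier_mat n n" and C: "C \<in> carrier_mat n n"
  shows "frob n (A * B) C = frob n B (mat_adjoint A * C)"
proof -
  have "frob n (A * B) C = mat_trace (A * (B * mat_adjoint C))"
    using A B C by (simp add: frob_trace[of _ n] assoc_mult_mat[of _ n n _ n _ n])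
  also have "\<dots> = mat_trace (B * mat_adjoint C * A)"
    using A B C by (intro mat_trace_comm[of _ n]) simp_all
  also have "\<dots> = frob n B (mat_adjoint A * C)"
    using A B C by (simp add: frob_trace[of _ n] adjoint_mult[of _ n n _ n] adjoint_adjoint
        assoc_mult_mat[of _ n n _ n _ n])
  finally show ?thesis .
qed

lemma frob_mult_right:
  assumes "A \<in> carrier_mat n n" "B \<in> carrier_mat n n" "C \<in> carrier_mat n n"
  shows "frob n (B * A) C = frob n B (C * mat_adjoint A)"
  using assms by (simp add: frob_trace[of _ n] adjoint_mult[of _ n n _ n] adjoint_adjoint
      assoc_mult_mat[of _ n n _ n _ n])

text \<open>
  The adjoint is an antiunitary map for the Frobenius inner product.
\<close>

lemma frob_adjoint_swap:
  assumes A: "A \<in> carrier_mat n n" and B: "B \<in> carrier_mat n n"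
  shows "frob n A B = frob n (mat_adjoint B) (mat_adjoint A)"
  using A B mat_trace_comm[OF A adjoint_carrier[OF B]]
  by (simp add: frob_trace[of _ n] adjoint_adjoint)

lemma frob_add_right:
  "\<lbrakk>A \<in> carrier_mat n n; B \<in> carrier_mat n n\<rbrakk> \<Longrightarrow>
    frob n C (A + B) = frob n C A + frob n C B"
  by (metis cnj_frob complex_cnj_add frob_add_left)

lemma frob_diff_right:
  "\<lbrakk>A \<in> carrier_mat n n; B \<in> carrier_mat n n\<rbrakk> \<Longrightarrow>
    frob n C (A - B) = frob n C A - frob n C B"
  by (metis cnj_frob complex_cnj_diff frob_diff_left)

lemma frob_mult_cols:
  assumes X: "X \<in> carrier_mat n n" and Y: "Y \<in> carrier_mat n n"
  shows "frob n (X * Y) Z = (\<Sum>j<n. hinner {..<n} (act n X (\<lambda>i. Y $$ (i, j))) (\<lambda>i. Z $$ (i, j)))"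
  unfolding frob_cols
  by (intro sum.cong refl hinner_cong) (simp_all add: mat_mult_index[OF X Y] act_def del: index_mult_mat)

lemma frob_sq_mult_cols:
  assumes X: "X \<in> carrier_mat n n" and Y: "Y \<in> carrier_mat n n"
  shows "frob_sq n (X * Y) = (\<Sum>j<n. sqnorm {..<n} (act n X (\<lambda>i. Y $$ (i, j))))"
proof -
  have "complex_of_real (frob_sq n (X * Y))
      = (\<Sum>j<n. hinner {..<n} (act n X (\<lambda>i. Y $$ (i, j))) (act n X (\<lambda>i. Y $$ (i, j))))"
    unfolding frob_self[symmetric] frob_cols
    by (intro sum.cong refl hinner_cong)
      (simp_all add: mat_mult_index[OF X Y] act_def del: index_mult_mat)
  then have "complex_of_real (frob_sq n (X * Y))
      = complex_of_real (\<Sum>j<n. sqnorm {..<n} (act n X (\<lambda>i. Y $$ (i, j))))"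
    by (simp add: hinner_self)
  then show ?thesis using of_real_eq_iff by blast
qed

lemma frob_sq_cols: "frob_sq n Y = (\<Sum>j<n. sqnorm {..<n} (\<lambda>i. Y $$ (i, j)))"
proof -
  have "complex_of_real (frob_sq n Y) = complex_of_real (\<Sum>j<n. sqnorm {..<n} (\<lambda>i. Y $$ (i, j)))"
    unfolding frob_self[symmetric] frob_cols by (simp add: hinner_self)
  then show ?thesis using of_real_eq_iff by blast
qed

lemma frob_sq_adjoint:
  assumes "Y \<in> carrier_mat n n"
  shows "frob_sq n (mat_adjoint Y) = frob_sq n Y"
proof -
  have "complex_of_real (frob_sq n (mat_adjoint Y)) = complex_of_real (frob_sq n Y)"
    unfolding frob_self[symmetric] using frob_adjoint_swap[OF assms assms] by simp
  then show ?thesis by simp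
qed

section \<open>The norm of a commutator\<close>

lemma commutator_carrier [simp]:
  "X \<in> carrier_mat n n \<Longrightarrow> Y \<in> carrier_mat n n \<Longrightarrow> commutator X Y \<in> carrier_mat n n"
  by (simp add: commutator_def minus_carrier_mat)

text \<open>
  Expanding both squares, the mixed terms are \<open>- 2 Re \<langle>X Y, Y X\<rangle>\<close> and \<open>+ 2 Re \<langle>Y X\<^sup>*, X\<^sup>* Y\<rangle>\<close>. The two
  inner products agree, by moving the right factor \<open>X\<close> of \<open>Y X\<close> and the left factor \<open>X\<close> of \<open>X Y\<close> to
  the other side.
\<close>

lemma commutator_anticommutator_identity:
  assumes X: "X \<in> carrier_mat n n" and Y: "Y \<in> carrier_mat n n"
  defines "D \<equiv> mat_adjoint X * Y + Y * mat_adjoint X"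
  shows "frob_sq n (commutator X Y) + frob_sq n D
    = frob_sq n (X * Y) + frob_sq n (Y * X)
      + frob_sq n (mat_adjoint X * Y) + frob_sq n (Y * mat_adjoint X)"
proof -
  let ?X' = "mat_adjoint X"
  have X': "?X' \<in> carrier_mat n n" using X by simp
  note car = square_mult_carrier[of _ n]
  have "frob n (X * Y) (Y * X) = frob n (X * Y * ?X') Y"
    using frob_mult_right[OF X' car[OF X Y] Y] by (simp add: adjoint_adjoint[OF X])
  also have "\<dots> = frob n (X * (Y * ?X')) Y"
    by (simp add: assoc_mult_mat[OF X Y X'])
  also have "\<dots> = frob n (Y * ?X') (?X' * Y)"
    by (rule frob_mult_left[OF X car[OF Y X'] Y])
  finally have cross: "frob n (X * Y) (Y * X) = frob n (Y * ?X') (?X' * Y)" .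
  then have cross': "frob n (Y * X) (X * Y) = frob n (?X' * Y) (Y * ?X')"
    by (metis cnj_frob)
  have "complex_of_real (frob_sq n (commutator X Y) + frob_sq n D)
     = frob n (commutator X Y) (commutator X Y) + frob n D D"
    by (simp add: frob_self)
  also have "\<dots> = complex_of_real (frob_sq n (X * Y) + frob_sq n (Y * X)
      + frob_sq n (?X' * Y) + frob_sq n (Y * ?X'))"
    using X Y X' cross cross'
    by (simp add: D_def commutator_def frob_diff_left frob_diff_right frob_add_left frob_add_right
        minus_carrier_mat frob_self[symmetric])
  finally show ?thesis using of_real_eq_iff by blast
qed

text \<open>
  The columns of \<open>Y\<close> followed by the columns of \<open>Y\<^sup>*\<close>, that is, a family whose density matrix
  \<open>\<Sum>k. v\<^sub>k v\<^sub>k\<^sup>*\<close> is \<open>Y Y\<^sup>* + Y\<^sup>* Y\<close>.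
\<close>

definition col_row_family :: "nat \<Rightarrow> complex mat \<Rightarrow> nat \<Rightarrow> nat \<Rightarrow> complex" where
  "col_row_family n Y k =
    (if k < n then (\<lambda>i. Y $$ (i, k)) else (\<lambda>i. mat_adjoint Y $$ (i, k - n)))"

lemma sum_col_row_family:
  fixes F :: "(nat \<Rightarrow> complex) \<Rightarrow> 'a :: comm_monoid_add"
  shows "(\<Sum>k<2 * n. F (col_row_family n Y k))
    = (\<Sum>j<n. F (\<lambda>i. Y $$ (i, j))) + (\<Sum>j<n. F (\<lambda>i. mat_adjoint Y $$ (i, j)))"
proof -
  have "(\<Sum>k<n + m. f k) = (\<Sum>k<n. f k) + (\<Sum>k<m. f (n + k))" for m and f :: "nat \<Rightarrow> 'a"
    by (induction m) (simp_all add: add.assoc)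
  then show ?thesis by (simp add: col_row_family_def mult_2)
qed

text \<open>
  With \<open>v\<^sub>k\<close> the columns of \<open>Y\<close> and \<open>Y\<^sup>*\<close>, the four terms of the identity for \<open>\<parallel>[X,Y]\<parallel>\<^sup>2 + \<parallel>D\<parallel>\<^sup>2\<close> add up to
  the sum of \<open>\<parallel>X v\<^sub>k\<parallel>\<^sup>2\<close> and \<open>\<parallel>X\<^sup>* v\<^sub>k\<parallel>\<^sup>2\<close>, and \<open>\<Sum>k. \<langle>X v\<^sub>k, v\<^sub>k\<rangle> = \<langle>Y, D\<rangle>\<close>. The variance bound then gives
  \<open>\<parallel>[X,Y]\<parallel>\<^sup>2 + \<parallel>D\<parallel>\<^sup>2 \<le> 2 B \<parallel>Y\<parallel>\<^sup>2 + \<parallel>D\<parallel>\<^sup>2 / 2\<close>.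
\<close>

lemma commutator_norm_bound:
  assumes X: "X \<in> carrier_mat n n" and Y: "Y \<in> carrier_mat n n" and n: "2 \<le> n"
    and pos: "0 < frob_sq n Y"
  shows "frob_sq n (commutator X Y) \<le> 2 * (norm_2_2 X)\<^sup>2 * frob_sq n Y"
proof -
  let ?S = "{..<n}" and ?X' = "mat_adjoint X" and ?Y' = "mat_adjoint Y" and ?v = "col_row_family n Y"
  have X': "?X' \<in> carrier_mat n n" and Y': "?Y' \<in> carrier_mat n n" using X Y by simp_all
  define D where "D = ?X' * Y + Y * ?X'"
  have D: "D \<in> carrier_mat n n" using X' Y by (simp add: D_def)
  note car = square_mult_carrier[of _ n]
  have "frob_sq n (Y * X) = frob_sq n (?X' * ?Y')" "frob_sq n (Y * ?X') = frob_sq n (X * ?Y')"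
    using frob_sq_adjoint[OF car[OF Y X]] frob_sq_adjoint[OF car[OF Y X']]
    by (simp_all add: adjoint_mult[OF Y X] adjoint_mult[OF Y X'] adjoint_adjoint[OF X])
  then have total: "frob_sq n (commutator X Y) + frob_sq n D
      = (\<Sum>k<2 * n. sqnorm ?S (act n X (?v k)) + sqnorm ?S (act n ?X' (?v k)))"
    unfolding D_def commutator_anticommutator_identity[OF X Y] sum.distrib
      sum_col_row_family[of "\<lambda>u. sqnorm ?S (act n X u)"]
      sum_col_row_family[of "\<lambda>u. sqnorm ?S (act n ?X' u)"]
    by (simp add: frob_sq_mult_cols[OF X Y] frob_sq_mult_cols[OF X Y'] frob_sq_mult_cols[OF X' Y]
        frob_sq_mult_cols[OF X' Y'])
  have "(\<Sum>k<2 * n. sqnorm ?S (?v k)) = 2 * frob_sq n Y"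
    unfolding sum_col_row_family[of "sqnorm ?S"] frob_sq_cols[symmetric] by (simp add: frob_sq_adjoint[OF Y])
  note bound = density_variance_bound[OF X n this]
  have s: "(\<Sum>k<2 * n. hinner ?S (act n X (?v k)) (?v k)) = frob n Y D"
  proof -
    have "(\<Sum>k<2 * n. hinner ?S (act n X (?v k)) (?v k)) = frob n (X * Y) Y + frob n (X * ?Y') ?Y'"
      unfolding sum_col_row_family[of "\<lambda>u. hinner ?S (act n X u) u"]
      by (simp add: frob_mult_cols[OF X Y] frob_mult_cols[OF X Y'])
    also have "frob n (X * Y) Y = frob n Y (?X' * Y)" by (rule frob_mult_left[OF X Y Y])
    also have "frob n (X * ?Y') ?Y' = frob n Y (Y * ?X')"
      using frob_adjoint_swap[OF car[OF X Y'] Y']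
      by (simp add: adjoint_mult[OF X Y'] adjoint_adjoint[OF Y])
    finally show ?thesis using X' Y by (simp add: D_def frob_add_right)
  qed
  have "(cmod (frob n Y D))\<^sup>2 \<le> frob_sq n Y * frob_sq n D"
    unfolding frob_def frob_sq_def by (rule cauchy_schwarz) simp
  then have "(cmod (frob n Y D))\<^sup>2 / (2 * frob_sq n Y) \<le> frob_sq n D / 2"
    using pos by (simp add: field_simps)
  moreover have "0 \<le> frob_sq n D" by (simp add: frob_sq_def sqnorm_nonneg)
  ultimately show ?thesis
    using bound pos unfolding total[symmetric] s by simp
qed

section \<open>Eigenvalues of the double commutator map\<close>

text \<open>
  \<open>ad X\<^sup>*\<close> is the Frobenius adjoint of \<open>ad X\<close>.
\<close>

lemma frob_T_map:
  assumes X: "X \<in> carrier_mat n n" and Y: "Y \<in> carrier_mat n n" and Z: "Z \<in> carrier_mat n n"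
  shows "frob n (T_map X Y) Z = frob n (commutator X Y) (commutator X Z)"
proof -
  let ?X' = "mat_adjoint X" and ?C = "commutator X Y"
  have X': "?X' \<in> carrier_mat n n" and C: "?C \<in> carrier_mat n n" using X Y by simp_all
  note car = square_mult_carrier[of _ n]
  have "frob n (T_map X Y) Z = frob n (?X' * ?C) Z - frob n (?C * ?X') Z"
    unfolding T_map_def by (subst commutator_def) (rule frob_diff_left[OF car[OF X' C] car[OF C X']])
  also have "frob n (?X' * ?C) Z = frob n ?C (X * Z)"
    using frob_mult_left[OF X' C Z] by (simp add: adjoint_adjoint[OF X])
  also have "frob n (?C * ?X') Z = frob n ?C (Z * X)"
    using frob_mult_right[OF X' C Z] by (simp add: adjoint_adjoint[OF X])
  also have "frob n ?C (X * Z) - frob n ?C (Z * X) = frob n ?C (X * Z - Z * X)"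
    using frob_diff_right[OF car[OF X Z] car[OF Z X]] by simp
  finally show ?thesis by (simp add: commutator_def[of X Z])
qed

lemma eigenvectors_orthogonal:
  assumes X: "X \<in> carrier_mat n n" and Y: "Y \<in> carrier_mat n n" and Z: "Z \<in> carrier_mat n n"
    and "T_map X Y = complex_of_real r \<cdot>\<^sub>m Y" "T_map X Z = complex_of_real t \<cdot>\<^sub>m Z" "r \<noteq> t"
  shows "frob n Y Z = 0"
proof -
  have "complex_of_real r * frob n Y Z = frob n (T_map X Y) Z"
    using assms(4) frob_smult_left[OF Y] by simp
  also have "\<dots> = cnj (frob n (T_map X Z) Y)"
    by (simp add: frob_T_map[OF X Y Z] frob_T_map[OF X Z Y] cnj_frob)
  also have "\<dots> = complex_of_real t * frob n Y Z"
    using assms(5) frob_smult_left[OF Z] by (simp add: cnj_frob)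
  finally show ?thesis using \<open>r \<noteq> t\<close> by simp
qed

text \<open>
  Eigenvectors for distinct real eigenvalues are orthogonal in a space of dimension \<open>n\<^sup>2\<close>. Finiteness
  is needed for the maximum that defines the largest eigenvalue to be meaningful.
\<close>

lemma finite_real_eigenvalues_T_map:
  assumes X: "X \<in> carrier_mat n n"
  shows "finite {r :: real. map_eigenvalue n (T_map X) (complex_of_real r)}" (is "finite ?R")
proof (rule ccontr)
  let ?S = "{..<n} \<times> {..<n}"
  assume "infinite ?R"
  then obtain K where K: "K \<subseteq> ?R" "finite K" "card K = Suc (card ?S)"
    using infinite_arbitrarily_large by blast
  from K(1) have "\<forall>r\<in>K. \<exists>Y. Y \<in> carrier_mat n n \<and> Y \<noteq> 0\<^sub>m n n \<and> T_map X Y = complex_of_real r \<cdot>\<^sub>m Y"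
    by (auto simp: map_eigenvalue_def)
  then obtain Y where Y: "\<And>r. r \<in> K \<Longrightarrow> Y r \<in> carrier_mat n n"
    "\<And>r. r \<in> K \<Longrightarrow> Y r \<noteq> 0\<^sub>m n n"
    "\<And>r. r \<in> K \<Longrightarrow> T_map X (Y r) = complex_of_real r \<cdot>\<^sub>m Y r"
    by metis
  have "orthonormal_family ?S K (\<lambda>r. normalized ?S (($$) (Y r)))"
    unfolding orthonormal_family_def
  proof (intro ballI)
    fix r t assume rt: "r \<in> K" "t \<in> K"
    show "hinner ?S (normalized ?S (($$) (Y r))) (normalized ?S (($$) (Y t))) = of_bool (r = t)"
    proof (cases "r = t")
      case True
      have "sqnorm ?S (($$) (Y t)) \<noteq> 0"
        using frob_sq_pos[OF Y(1)[OF rt(2)] Y(2)[OF rt(2)]] by (simp add: frob_sq_def)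
      then show ?thesis using True by (simp add: hinner_normalized_self)
    next
      case False
      have "hinner ?S (($$) (Y r)) (($$) (Y t)) = 0"
        using eigenvectors_orthogonal[OF X Y(1)[OF rt(1)] Y(1)[OF rt(2)] Y(3)[OF rt(1)] Y(3)[OF rt(2)] False]
        by (simp add: frob_def)
      then show ?thesis
        using False by (simp add: normalized_def hinner_scale_left hinner_scale_right del: of_real_divide)
    qed
  qed
  then have "card K \<le> card ?S" using K(2) by (intro card_orthonormal_family_le) auto
  then show False using K(3) by simp
qed

text \<open>
  The identity matrix commutes with \<open>X\<close>. This makes the set of eigenvalues nonempty.
\<close>

lemma zero_eigenvalue_T_map:
  assumes X: "X \<in> carrier_mat n n" and "0 < n"
  shows "map_eigenvalue n (T_map X) 0"
proof -
  have "commutator X (1\<^sub>m n) = 0\<^sub>m n n" using X by (simp add: commutator_def)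
  then have "T_map X (1\<^sub>m n) = 0\<^sub>m n n" using X by (simp add: T_map_def commutator_def)
  moreover have "0 \<cdot>\<^sub>m 1\<^sub>m n = (0\<^sub>m n n :: complex mat)" by (rule eq_matI) auto
  moreover have "(1\<^sub>m n :: complex mat) \<noteq> 0\<^sub>m n n"
  proof
    assume "(1\<^sub>m n :: complex mat) = 0\<^sub>m n n"
    then have "(1\<^sub>m n :: complex mat) $$ (0, 0) = 0\<^sub>m n n $$ (0, 0)" by simp
    then show False using \<open>0 < n\<close> by simp
  qed
  ultimately show ?thesis unfolding map_eigenvalue_def by (intro bexI[of _ "1\<^sub>m n"]) auto
qed

lemma eigenvalue_T_map_le:
  assumes X: "X \<in> carrier_mat n n" and n: "2 \<le> n"
    and "map_eigenvalue n (T_map X) (complex_of_real r)"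
  shows "r \<le> 2 * (norm_2_2 X)\<^sup>2"
proof -
  obtain Y where Y: "Y \<in> carrier_mat n n" "Y \<noteq> 0\<^sub>m n n" "T_map X Y = complex_of_real r \<cdot>\<^sub>m Y"
    using assms(3) by (auto simp: map_eigenvalue_def)
  have pos: "0 < frob_sq n Y" using Y(1,2) by (rule frob_sq_pos)
  have "complex_of_real (r * frob_sq n Y) = frob n (T_map X Y) Y"
    using Y(3) frob_smult_left[OF Y(1)] by (simp add: frob_self)
  also have "\<dots> = complex_of_real (frob_sq n (commutator X Y))"
    by (simp add: frob_T_map[OF X Y(1) Y(1)] frob_self)
  finally have "r * frob_sq n Y = frob_sq n (commutator X Y)" using of_real_eq_iff by blast
  also have "\<dots> \<le> 2 * (norm_2_2 X)\<^sup>2 * frob_sq n Y"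
    by (rule commutator_norm_bound[OF X Y(1) n pos])
  finally show ?thesis using pos by simp
qed

theorem theorem3p4:
  fixes n :: nat and X :: "complex mat"
  assumes "n \<ge> 2"
    and "X \<in> carrier_mat n n"
    and "frobenius_norm X = 1"
  shows "largest_eigenvalue n (T_map X) \<le> 2 * (norm_2_2 X)\<^sup>2 \<and> 2 * (norm_2_2 X)\<^sup>2 \<le> 2"
proof
  let ?R = "{r :: real. map_eigenvalue n (T_map X) (complex_of_real r)}"
  have "0 \<in> ?R" using zero_eigenvalue_T_map[OF assms(2)] assms(1) by simp
  then have "?R \<noteq> {}" by blast
  then show "largest_eigenvalue n (T_map X) \<le> 2 * (norm_2_2 X)\<^sup>2"
    unfolding largest_eigenvalue_def
    using finite_real_eigenvalues_T_map[OF assms(2)] eigenvalue_T_map_le[OF assms(2,1)]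
    by (intro Max.boundedI) blast+
  show "2 * (norm_2_2 X)\<^sup>2 \<le> 2"
    using norm_2_2_le_frobenius[OF assms(2,1)] assms(3) by simp
qed

end
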